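(* For any prime power $q$ and any integer $t \geq 2$ such that $q \equiv 0 \pmod t$ or $q \equiv 1 \pmod t$, there exists a graph $G$ with the following properties: (1) $G$ has $q(q-1)/t$ vertices; (2) $G$ has no multiple edges but some vertices have loops; (3) $G$ is regular of degree $q-1$ (loops contribute one to the degree); (4) $G$ is $K_{2,t+1}$-free; (5) the second largest eigenvalue of the adjacency matrix of $G$ is $\sqrt{q}$.
   Context: Graphs here are undirected and may have loops; the adjacency matrix is the symmetric $0/1$ matrix with a diagonal entry $1$ exactly at the vertices having a loop. $K_{2,t+1}$ is the complete bipartite graph with parts of sizes $2$ and $t+1$, and "$K_{2,t+1}$-free" means that $G$ does not contain $K_{2,t+1}$ as a (not necessarily induced) subgraph.
   Formalization: Property (5) is claimed only for t < q-1; for t = q and t = q-1 it fails for every graph satisfying (1)–(3), since the eigenvalues other than q-1 are then 0 or ±1 (e.g. q = 3, t = 2). Properties (1)–(4) are proved for all t. *)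

theory Defs
  imports
    Complex_Main
    "HOL-Number_Theory.Cong"
    "HOL-Number_Theory.Prime_Powers"
    "Jordan_Normal_Form.Char_Poly"
    "Graph_Theory.Digraph_Component"
    "Graph_Theory.Kuratowski"
begin

text \<open>
  Undirected graphs are symmetric digraphs: an edge between distinct vertices is a pair of opposite
  arcs, whereas a loop is a single arc. The out-degree of a vertex is thus its degree, with loops
  contributing one.
\<close>

text \<open>The vertices are listed in increasing order; another order would only conjugate the matrix by
  a permutation matrix.\<close>

definition adjacency_matrix :: "('a :: linorder, 'b) pre_digraph \<Rightarrow> real mat" where
  "adjacency_matrix G =
     (let vs = sorted_list_of_set (verts G); n = length vs
      in mat n n (\<lambda>(i, j). if (vs ! i, vs ! j) \<in> arcs_ends G then 1 else 0))"

definition has_loop :: "('a, 'b) pre_digraph \<Rightarrow> bool" where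
  "has_loop G \<longleftrightarrow> (\<exists>v \<in> verts G. (v, v) \<in> arcs_ends G)"

definition regular_of_degree :: "('a, 'b) pre_digraph \<Rightarrow> nat \<Rightarrow> bool" where
  "regular_of_degree G d \<longleftrightarrow> (\<forall>v \<in> verts G. out_degree G v = d)"

definition complete_bipartite_free :: "nat \<Rightarrow> nat \<Rightarrow> ('a, 'b) pre_digraph \<Rightarrow> bool" where
  "complete_bipartite_free m n G \<longleftrightarrow>
     \<not> (\<exists>K. subgraph K G \<and> complete_bipartite_digraph m n K)"

text \<open>Eigenvalues are listed with multiplicity. Only real ones occur in the list, which for a
  symmetric matrix is all of them.\<close>

definition eigenvalues_desc :: "real mat \<Rightarrow> real list" where
  "eigenvalues_desc A = rev (sorted_list_of_multiset (proots (char_poly A)))"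

definition second_largest_eigenvalue_is :: "real mat \<Rightarrow> real \<Rightarrow> bool" where
  "second_largest_eigenvalue_is A x \<longleftrightarrow>
     length (eigenvalues_desc A) \<ge> 2 \<and> eigenvalues_desc A ! 1 = x"

text \<open>
  A caveat on the range of \<open>t\<close>. Let \<open>G\<close> have \<open>n = q (q - 1) / t\<close> vertices and be regular of degree
  \<open>q - 1\<close>. The trace of the square of its adjacency matrix is \<open>n (q - 1)\<close>, and \<open>q - 1\<close> is an
  eigenvalue, so the squares of the other eigenvalues sum to \<open>n (q - 1) - (q - 1)^2\<close>. This is \<open>0\<close>
  for \<open>t = q\<close> and \<open>q - 1\<close> for \<open>t = q - 1\<close>, hence less than \<open>q\<close>, and \<open>sqrt q\<close> cannot be the second
  largest eigenvalue. Under the divisibility conditions all other values of \<open>t\<close> satisfy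
  \<open>t < q - 1\<close>, which is why the eigenvalue claim is stated under that condition.
\<close>

end

theory Submission
  imports
    Defs
    "HOL-Number_Theory.Residues"
    "HOL-Algebra.Algebraic_Closure"
    "HOL-Algebra.Sylow"
begin

text \<open>
  Let \<open>F\<close> be the field of order \<open>q\<close>. If \<open>t\<close> divides \<open>q - 1\<close>, let \<open>l\<close> be the quotient map of the unit group
  of \<open>F\<close> by its subgroup of order \<open>t\<close>; the vertices are the pairs \<open>(a, x)\<close> of a class \<open>a\<close> and an element
  \<open>x\<close> of \<open>F\<close>, and \<open>(a, x)\<close> is adjacent to \<open>(b, y)\<close> iff \<open>l (x + y + 1) = a b\<close>. If \<open>t\<close> divides \<open>q\<close>, let \<open>\<pi>\<close> be the
  quotient map of the additive group by a subgroup of order \<open>t\<close>; the vertices are the pairs \<open>(a, X)\<close>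
  of a unit \<open>a\<close> and a class \<open>X\<close>, and \<open>(a, X)\<close> is adjacent to \<open>(b, Y)\<close> iff \<open>\<pi> (a b - 1) = X + Y\<close>. The
  summand \<open>1\<close> provides a loop also in characteristic \<open>2\<close>.

  In both cases the vertices form a grid and the adjacency matrix satisfies
  \<open>A\<^sup>2 = q I + t J - t R - S\<close>, where \<open>R\<close> and \<open>S\<close> are the indicator matrices of lying in the same row
  or column. As \<open>R\<close> and \<open>S\<close> are positive semidefinite, \<open>A\<^sup>2 \<le> q\<close> on the complement of the constant
  vectors. On vectors with vanishing row and column sums, \<open>A\<^sup>2 = q\<close>; hence for such a vector \<open>g\<close>
  the vector \<open>A g + sqrt q g\<close> is an eigenvector for \<open>sqrt q\<close> unless it is zero, which is excluded by taking
  for \<open>g\<close> the signed indicator of a rectangle with a corner at a loop.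
\<close>

section \<open>The second eigenvalue of a regular symmetric matrix\<close>

text \<open>The basis change replaces the first unit vector by the constant vector.\<close>

lemma constant_row_sum_char_poly:
  fixes A :: "'a :: field mat"
  assumes A: "A \<in> carrier_mat (Suc m) (Suc m)"
    and rows: "\<And>i. i < Suc m \<Longrightarrow> (\<Sum>j<Suc m. A $$ (i, j)) = d"
  shows "char_poly A = [:- d, 1:] * char_poly (mat m m (\<lambda>(i, j). A $$ (Suc i, Suc j) - A $$ (0, Suc j)))"
proof -
  let ?n = "Suc m"
  define B where "B = mat m m (\<lambda>(i, j). A $$ (Suc i, Suc j) - A $$ (0, Suc j))"
  define D where "D = mat 1 1 (\<lambda>_. d)"
  define R where "R = mat 1 m (\<lambda>(i, j). A $$ (0, Suc j))"
  define C where "C = four_block_mat D R (0\<^sub>m m 1) B"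
  define P where "P = mat ?n ?n (\<lambda>(i, j). if j = 0 then 1 else if i = j then 1 else 0 :: 'a)"
  define Q where "Q = mat ?n ?n (\<lambda>(i, j). if i = j then 1 else if j = 0 then - 1 else 0 :: 'a)"
  have [simp]: "dim_row A = ?n" "dim_col A = ?n" using A by auto
  have car: "D \<in> carrier_mat 1 1" "R \<in> carrier_mat 1 m" "B \<in> carrier_mat m m"
    by (auto simp: D_def R_def B_def)
  have C: "C \<in> carrier_mat ?n ?n"
    unfolding C_def using car by (metis four_block_carrier_mat plus_1_eq_Suc)
  have P: "P \<in> carrier_mat ?n ?n" and Q: "Q \<in> carrier_mat ?n ?n" by (auto simp: P_def Q_def)
  have prod: "(M * N) $$ (i, j) = (\<Sum>k<?n. M $$ (i, k) * N $$ (k, j))"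
    if "M \<in> carrier_mat ?n ?n" "N \<in> carrier_mat ?n ?n" "i < ?n" "j < ?n" for M N :: "'a mat" and i j
    using that by (auto simp: scalar_prod_def lessThan_atLeast0 intro!: sum.cong)
  have split0: "(\<Sum>k<?n. f k) = f 0 + (\<Sum>k\<in>{1..<?n}. f k)" for f :: "nat \<Rightarrow> 'a"
    by (simp add: lessThan_atLeast0 sum.atLeast_Suc_lessThan)
  have delta: "(\<Sum>k\<in>{1..<?n}. if i = k then f k else 0) = (if 1 \<le> i \<and> i < ?n then f i else 0)"
    for f :: "nat \<Rightarrow> 'a" and i
    by (simp add: sum.delta')
  have Pl: "(P * M) $$ (i, j) = (if i = 0 then M $$ (0, j) else M $$ (0, j) + M $$ (i, j))"
    if M: "M \<in> carrier_mat ?n ?n" and ij: "i < ?n" "j < ?n" for M i j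
  proof -
    have "(P * M) $$ (i, j) = (\<Sum>k<?n. P $$ (i, k) * M $$ (k, j))" using prod P M ij by blast
    also have "\<dots> = M $$ (0, j) + (\<Sum>k\<in>{1..<?n}. if i = k then M $$ (k, j) else 0)"
    proof -
      have "(\<Sum>k\<in>{1..<?n}. P $$ (i, k) * M $$ (k, j)) = (\<Sum>k\<in>{1..<?n}. if i = k then M $$ (k, j) else 0)"
        by (rule sum.cong[OF refl]) (use ij in \<open>auto simp: P_def\<close>)
      then show ?thesis using ij unfolding split0 by (simp add: P_def)
    qed
    finally show ?thesis using ij unfolding delta by auto
  qed
  have PQ: "P * Q = 1\<^sub>m ?n"
    by (rule eq_matI, insert P Q, auto simp del: index_mult_mat(1) simp: Pl[OF Q]) (auto simp: Q_def)
  have QP: "Q * P = 1\<^sub>m ?n"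
    using PQ P Q by (metis mat_mult_left_right_inverse)
  \<comment> \<open>Column \<open>0\<close> of \<open>A * P\<close> holds the row sums of
    \<open>A\<close>, all equal to \<open>d\<close>, and \<open>P\<close> sends the first unit
    vector to the constant vector; so column \<open>0\<close> of \<open>C\<close> is
    \<open>d\<close> followed by zeros.\<close>
  have APC: "A * P = P * C"
  proof (rule eq_matI, insert P C, simp_all del: index_mult_mat(1))
    fix i j assume ij: "i < ?n" "j < ?n"
    have "(A * P) $$ (i, j) = (\<Sum>k<?n. A $$ (i, k) * P $$ (k, j))" using prod P A ij by blast
    also have "\<dots> = (if j = 0 then d else A $$ (i, j))"
    proof (cases "j = 0")
      case True
      then show ?thesis using rows[of i] ij by (simp add: P_def)
    next
      case False
      have "(\<Sum>k<?n. A $$ (i, k) * P $$ (k, j)) = (\<Sum>k<?n. if k = j then A $$ (i, k) else 0)"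
        using ij False by (intro sum.cong) (auto simp: P_def)
      then show ?thesis using ij False by simp
    qed
    also have "\<dots> = (P * C) $$ (i, j)"
      unfolding Pl[OF C ij] using ij car by (auto simp: C_def D_def R_def B_def)
    finally show "(A * P) $$ (i, j) = (P * C) $$ (i, j)" .
  qed
  have "A = P * C * Q"
    using APC PQ A P Q C by (metis assoc_mult_mat right_mult_one_mat)
  then have "similar_mat A C"
    using A P Q C PQ QP by (intro similar_matI[of _ _ P Q ?n]) auto
  then have "char_poly A = char_poly C" by (rule char_poly_similar)
  also have "\<dots> = char_poly D * char_poly B"
    unfolding C_def using car by (rule char_poly_four_block_zeros_col)
  also have "char_poly D = [:- d, 1:]"
    by (simp add: D_def char_poly_defs det_def sign_def)
  finally show ?thesis unfolding B_def .
qed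

text \<open>The preceding factorisation splits one copy of \<open>d\<close> off the spectrum and
  leaves the characteristic polynomial of the deflated matrix. The assumption \<open>perp\<close>
  bounds all its roots by \<open>\<mu>\<close>, while the eigenvector \<open>f\<close> makes
  \<open>\<mu>\<close> one of them because \<open>\<mu> < d\<close>; the ascending list of roots
  therefore ends in \<open>\<mu>, d\<close>. In this way \<open>A\<close> need not be
  diagonalised.\<close>

lemma second_largest_eigenvalueI:
  fixes A :: "real mat"
  assumes A: "A \<in> carrier_mat n n"
    and sym: "\<And>i j. i < n \<Longrightarrow> j < n \<Longrightarrow> A $$ (i, j) = A $$ (j, i)"
    and rows: "\<And>i. i < n \<Longrightarrow> (\<Sum>j<n. A $$ (i, j)) = d"
    and less: "\<mu> < d"
    and f: "i0 < n" "f i0 \<noteq> 0" "\<And>i. i < n \<Longrightarrow> (\<Sum>j<n. A $$ (i, j) * f j) = \<mu> * f i"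
    and perp: "\<And>z \<nu> i. (\<Sum>j<n. z j) = 0 \<Longrightarrow> (\<And>i. i < n \<Longrightarrow> (\<Sum>j<n. A $$ (i, j) * z j) = \<nu> * z i)
                 \<Longrightarrow> i < n \<Longrightarrow> z i \<noteq> 0 \<Longrightarrow> \<nu> \<le> \<mu>"
  shows "second_largest_eigenvalue_is A \<mu>"
proof -
  obtain m where n: "n = Suc m" using \<open>i0 < n\<close> by (cases n) auto
  define B where "B = mat m m (\<lambda>(i, j). A $$ (Suc i, Suc j) - A $$ (0, Suc j))"
  have B: "B \<in> carrier_mat m m" by (simp add: B_def)
  have cp: "char_poly A = [:- d, 1:] * char_poly B"
    unfolding B_def using A rows n by (intro constant_row_sum_char_poly) auto
  have cpB0: "char_poly B \<noteq> 0" using degree_monic_char_poly[OF B] by (metis coeff_0 zero_neq_one)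
  have rootB: "\<nu> \<le> \<mu>" if "poly (char_poly B) \<nu> = 0" for \<nu>
  proof -
    have "poly (char_poly (transpose_mat B)) \<nu> = 0" using that B by simp
    then have "eigenvalue (transpose_mat B) \<nu>"
      using eigenvalue_root_char_poly[of "transpose_mat B" m] B by simp
    then obtain v where v: "v \<in> carrier_vec m" "v \<noteq> 0\<^sub>v m" "transpose_mat B *\<^sub>v v = \<nu> \<cdot>\<^sub>v v"
      using B unfolding eigenvalue_def eigenvector_def by auto
    obtain k where k: "k < m" "v $ k \<noteq> 0" using v by (metis eq_vecI carrier_vecD index_zero_vec)
    \<comment> \<open>A left eigenvector of the deflated matrix, completed to coordinate sum \<open>0\<close>, is an eigenvector of \<open>A\<close>.\<close>
    define z where "z j = (if j = 0 then - (\<Sum>i<m. v $ i) else v $ (j - 1))" for j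
    have z0: "(\<Sum>j<n. z j) = 0" unfolding n sum.lessThan_Suc_shift by (simp add: z_def)
    have Bv: "(\<Sum>i<m. B $$ (i, j) * v $ i) = \<nu> * v $ j" if "j < m" for j
    proof -
      have "(transpose_mat B *\<^sub>v v) $ j = \<nu> * v $ j" using v that by simp
      then show ?thesis using that v(1) B by (simp add: scalar_prod_def lessThan_atLeast0)
    qed
    have Az: "(\<Sum>k<n. A $$ (Suc j, k) * z k) = \<nu> * z (Suc j)" if "j < m" for j
    proof -
      have "(\<Sum>k<n. A $$ (Suc j, k) * z k) = (\<Sum>k<n. A $$ (k, Suc j) * z k)"
        using that n sym by (intro sum.cong) auto
      also have "\<dots> = (\<Sum>i<m. B $$ (i, j) * v $ i)"
        using that unfolding n sum.lessThan_Suc_shift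
        by (simp add: z_def B_def algebra_simps sum_subtractf sum_distrib_right)
      finally show ?thesis using Bv that by (simp add: z_def)
    qed
    \<comment> \<open>The coordinates of \<open>A z\<close> add up to \<open>d\<close> times the
      coordinate sum of \<open>z\<close>, that is to \<open>0\<close>. This yields the equation at
      coordinate \<open>0\<close>, the only one that the deflated matrix does not supply.\<close>
    have "(\<Sum>i<n. \<Sum>j<n. A $$ (i, j) * z j) = (\<Sum>j<n. \<Sum>i<n. A $$ (j, i) * z j)"
      by (subst sum.swap) (use sym in \<open>auto intro!: sum.cong\<close>)
    also have "\<dots> = (\<Sum>j<n. d * z j)"
      using rows by (intro sum.cong) (auto simp: sum_distrib_right[symmetric])
    also have "\<dots> = 0" by (simp add: sum_distrib_left[symmetric] z0)
    finally have "(\<Sum>j<n. A $$ (0, j) * z j) + (\<Sum>i<m. \<Sum>j<n. A $$ (Suc i, j) * z j) = 0"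
      unfolding n sum.lessThan_Suc_shift[of _ m] by (simp del: sum.lessThan_Suc)
    moreover have "(\<Sum>i<m. \<Sum>j<n. A $$ (Suc i, j) * z j) = \<nu> * (\<Sum>i<m. v $ i)"
      using Az by (simp add: z_def sum_distrib_left)
    ultimately have "(\<Sum>j<n. A $$ (0, j) * z j) = \<nu> * z 0" by (simp add: z_def)
    then have "(\<Sum>j<n. A $$ (i, j) * z j) = \<nu> * z i" if "i < n" for i
      using Az that n by (cases i) auto
    then show "\<nu> \<le> \<mu>" using z0 k n by (intro perp[of z \<nu> "Suc k"]) (auto simp: z_def)
  qed
  have "eigenvector A (vec n f) \<mu>"
    unfolding eigenvector_def
  proof (intro conjI)
    show "vec n f \<noteq> 0\<^sub>v (dim_row A)" using f A by (metis carrier_matD(1) index_vec index_zero_vec(1))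
    show "A *\<^sub>v vec n f = \<mu> \<cdot>\<^sub>v vec n f"
      by (rule eq_vecI) (use f A in \<open>auto simp: scalar_prod_def lessThan_atLeast0\<close>)
  qed (use A in auto)
  then have "poly (char_poly A) \<mu> = 0"
    using eigenvalue_root_char_poly[OF A] unfolding eigenvalue_def by blast
  then have rootmu: "poly (char_poly B) \<mu> = 0" using less by (simp add: cp)
  define M where "M = proots (char_poly B)"
  have setM: "x \<in># M \<longleftrightarrow> poly (char_poly B) x = 0" for x using cpB0 by (simp add: M_def)
  have muM: "\<mu> \<in># M" using setM rootmu by blast
  then obtain N where N: "M = add_mset \<mu> N" by (metis mset_add)
  have roots: "proots (char_poly A) = add_mset d (add_mset \<mu> N)"
  proof -
    have "[:- d, 1:] \<noteq> 0" by simp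
    then have "proots (char_poly A) = {#d#} + M"
      unfolding cp M_def by (subst proots_mult) (use cpB0 in auto)
    then show ?thesis by (simp add: N)
  qed
  have leN: "x \<le> \<mu>" if "x \<in># N" for x using that N rootB setM by (metis insert_iff set_mset_add_mset_insert)
  define xs where "xs = sorted_list_of_multiset N @ [\<mu>, d]"
  have "x \<le> d" if "x \<in># N" for x using leN[OF that] less by simp
  then have "sorted xs" using leN less by (auto simp: xs_def sorted_append)
  moreover have "mset xs = add_mset d (add_mset \<mu> N)" by (simp add: xs_def)
  ultimately have "sorted_list_of_multiset (proots (char_poly A)) = xs"
    unfolding roots by (metis sorted_list_of_multiset_mset sorted_sort_id)
  then show ?thesis
    unfolding second_largest_eigenvalue_is_def eigenvalues_desc_def by (simp add: xs_def)
qed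

section \<open>Graphs with prescribed common neighbourhoods\<close>

text \<open>The quadratic form of the indicator matrix of an equivalence relation is the sum, over
  the classes, of the squared sum of \<open>z\<close> on the class.\<close>

lemma class_sum_nonneg:
  fixes z :: "'v \<Rightarrow> real"
  assumes "finite V"
  shows "0 \<le> (\<Sum>j\<in>V. \<Sum>k\<in>V. of_bool (r j = r k) * (z j * z k))"
proof -
  have "(\<Sum>j\<in>V. \<Sum>k\<in>V. of_bool (r j = r k) * (z j * z k)) =
      (\<Sum>j\<in>V. \<Sum>k\<in>V. \<Sum>\<rho>\<in>r ` V. if \<rho> = r j then of_bool (\<rho> = r k) * (z j * z k) else 0)"
    using assms by (intro sum.cong refl) (auto simp: sum.delta)
  also have "\<dots> = (\<Sum>j\<in>V. \<Sum>\<rho>\<in>r ` V. \<Sum>k\<in>V. if \<rho> = r j then of_bool (\<rho> = r k) * (z j * z k) else 0)"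
    by (intro sum.cong refl sum.swap)
  also have "\<dots> = (\<Sum>\<rho>\<in>r ` V. \<Sum>j\<in>V. \<Sum>k\<in>V. if \<rho> = r j then of_bool (\<rho> = r k) * (z j * z k) else 0)"
    by (rule sum.swap)
  also have "\<dots> = (\<Sum>\<rho>\<in>r ` V. (\<Sum>j\<in>V. of_bool (\<rho> = r j) * z j)\<^sup>2)"
    by (auto simp: power2_eq_square sum_product intro!: sum.cong)
  also have "\<dots> \<ge> 0" by (intro sum_nonneg) simp
  finally show ?thesis .
qed

text \<open>The assumption \<open>common\<close> is the entrywise form of
  \<open>A\<^sup>2 = q I + t J - t R - S\<close>, with \<open>r\<close> and \<open>s\<close>
  labelling the two directions of the grid. The points \<open>v\<close>, \<open>w\<close>,
  \<open>x\<close> complete the loop vertex \<open>u\<close> to a rectangle. The bound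
  \<open>2 < q\<close> gives \<open>sqrt q < q - 1\<close>, so that the degree is the strictly
  largest eigenvalue.\<close>

lemma second_largest_eigenvalue_of_common_counts:
  fixes E :: "nat \<Rightarrow> nat \<Rightarrow> bool" and q t n :: nat
  defines "A \<equiv> mat n n (\<lambda>(i, j). if E i j then 1 else 0 :: real)"
  assumes sym: "\<And>i j. i < n \<Longrightarrow> j < n \<Longrightarrow> E i j \<Longrightarrow> E j i"
    and common: "\<And>i j. i < n \<Longrightarrow> j < n \<Longrightarrow> real (card {k. k < n \<and> E i k \<and> E j k}) =
        real q * of_bool (i = j) + real t - real t * of_bool (r i = r j) - of_bool (s i = s j)"
    and q: "2 < q"
    and loop: "u < n" "E u u"
    and rect: "v < n" "w < n" "x < n" "r v = r u" "s v \<noteq> s u" "s w = s u" "r w \<noteq> r u" "r x = r w" "s x = s v"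
  shows "second_largest_eigenvalue_is A (sqrt (real q))"
proof -
  define a where "a i j = (of_bool (E i j) :: real)" for i j
  define c where "c i j = real q * of_bool (i = j) + real t - real t * of_bool (r i = r j) - of_bool (s i = s j)" for i j
  have A: "A \<in> carrier_mat n n" by (simp add: A_def)
  have Aa: "A $$ (i, j) = a i j" if "i < n" "j < n" for i j using that by (simp add: A_def a_def)
  have a_sym: "a i j = a j i" if "i < n" "j < n" for i j using that sym by (auto simp: a_def)
  have sq: "(\<Sum>k<n. a i k * a j k) = c i j" if "i < n" "j < n" for i j
  proof -
    have "(\<Sum>k<n. a i k * a j k) = (\<Sum>k\<in>{k. k < n \<and> E i k \<and> E j k}. 1)"
      by (intro sum.mono_neutral_cong_right) (auto simp: a_def)
    then show ?thesis using common that by (simp add: c_def)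
  qed
  \<comment> \<open>The entries are \<open>0\<close> or \<open>1\<close>, so a row sum is also a sum
    of squares, that is the diagonal entry \<open>c i i\<close>.\<close>
  have rows: "(\<Sum>j<n. A $$ (i, j)) = real q - 1" if "i < n" for i
  proof -
    have "(\<Sum>j<n. A $$ (i, j)) = (\<Sum>j<n. a i j * a i j)"
      using that by (intro sum.cong) (auto simp: Aa a_def)
    also have "\<dots> = real q - 1" using that by (simp add: sq c_def)
    finally show ?thesis .
  qed
  have less: "sqrt (real q) < real q - 1"
  proof (rule real_less_lsqrt)
    have "real q < (real q - 1) * (real q - 1)"
    proof -
      have "3 * real q \<le> real q * real q" using q by (intro mult_right_mono) auto
      then show ?thesis by (simp add: algebra_simps)
    qed
    then show "real q < (real q - 1)\<^sup>2" by (simp add: power2_eq_square)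
  qed (use q in auto)
  have c_apply: "(\<Sum>j<n. c i j * z j) = real q * z i + real t * (\<Sum>j<n. z j)
      - real t * (\<Sum>j<n. of_bool (r i = r j) * z j) - (\<Sum>j<n. of_bool (s i = s j) * z j)"
    if "i < n" for i z
  proof -
    have "(\<Sum>j<n. c i j * z j) = (\<Sum>j<n. (if i = j then real q * z j else 0) + real t * z j
      - real t * (of_bool (r i = r j) * z j) - of_bool (s i = s j) * z j)"
      by (intro sum.cong) (auto simp: c_def algebra_simps)
    also have "\<dots> = (\<Sum>j<n. if i = j then real q * z j else 0) + real t * (\<Sum>j<n. z j)
        - real t * (\<Sum>j<n. of_bool (r i = r j) * z j) - (\<Sum>j<n. of_bool (s i = s j) * z j)"
      by (simp only: sum.distrib sum_subtractf sum_distrib_left)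
    finally show ?thesis using that by simp
  qed
  \<comment> \<open>The signs alternate around the rectangle, so \<open>g\<close> sums to zero on
    each class of \<open>r\<close> and on each class of \<open>s\<close>; hence \<open>c\<close>
    acts on \<open>g\<close> as multiplication by \<open>q\<close>.\<close>
  define g where "g i = (of_bool (i = u) - of_bool (i = v) - of_bool (i = w) + of_bool (i = x) :: real)" for i
  have g_sum: "(\<Sum>j<n. h j * g j) = h u - h v - h w + h x" for h :: "nat \<Rightarrow> real"
  proof -
    have "(\<Sum>j<n. h j * g j) = (\<Sum>j<n. (if j = u then h j else 0) - (if j = v then h j else 0)
        - (if j = w then h j else 0) + (if j = x then h j else 0))"
      by (intro sum.cong) (auto simp: g_def)
    also have "\<dots> = h u - h v - h w + h x"
      unfolding sum.distrib sum_subtractf using loop rect by simp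
    finally show ?thesis .
  qed
  \<comment> \<open>Applying \<open>A - sqrt q\<close> to \<open>f = (A + sqrt q) g\<close> gives
    \<open>(A\<^sup>2 - q) g = 0\<close>.\<close>
  define f where "f i = (\<Sum>j<n. a i j * g j) + sqrt (real q) * g i" for i
  show ?thesis
  proof (rule second_largest_eigenvalueI[OF A _ rows less \<open>u < n\<close>])
    show "A $$ (i, j) = A $$ (j, i)" if "i < n" "j < n" for i j
      using that a_sym by (simp add: Aa)
    have "u \<noteq> v" "u \<noteq> w" "u \<noteq> x" using rect by auto
    then have gu: "g u = 1" by (simp add: g_def)
    \<comment> \<open>The loop contributes \<open>a u u = 1\<close>, so \<open>A g\<close> is at
      least \<open>-1\<close> at \<open>u\<close>, and \<open>sqrt q * g u > 1\<close> outweighs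
      it.\<close>
    have "a u u - a u v - a u w + a u x \<ge> -1" using loop by (simp add: a_def of_bool_def)
    moreover have "1 < sqrt (real q)" using q by simp
    ultimately have "0 < f u" unfolding f_def g_sum gu by linarith
    then show "f u \<noteq> 0" by simp
    show "(\<Sum>j<n. A $$ (i, j) * f j) = sqrt (real q) * f i" if i: "i < n" for i
    proof -
      have "(\<Sum>j<n. A $$ (i, j) * f j) = (\<Sum>j<n. \<Sum>k<n. a i j * a k j * g k) + sqrt (real q) * (\<Sum>j<n. a i j * g j)"
      proof -
        have "(\<Sum>j<n. A $$ (i, j) * f j) = (\<Sum>j<n. (\<Sum>k<n. a i j * a k j * g k) + sqrt (real q) * (a i j * g j))"
        proof (intro sum.cong refl)
          fix j assume j: "j \<in> {..<n}"
          have "(\<Sum>k<n. a j k * g k) = (\<Sum>k<n. a k j * g k)"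
            using j a_sym by (intro sum.cong) auto
          then show "A $$ (i, j) * f j = (\<Sum>k<n. a i j * a k j * g k) + sqrt (real q) * (a i j * g j)"
            using i j by (simp add: Aa f_def algebra_simps sum_distrib_left)
        qed
        then show ?thesis by (simp add: sum.distrib sum_distrib_left)
      qed
      also have "(\<Sum>j<n. \<Sum>k<n. a i j * a k j * g k) = (\<Sum>k<n. c i k * g k)"
        by (subst sum.swap) (use i in \<open>auto simp: sum_distrib_right[symmetric] sq intro!: sum.cong\<close>)
      also have "\<dots> = real q * g i"
        unfolding c_apply[OF i] g_sum using g_sum[of "\<lambda>_. 1"] rect by simp
      also have "real q = sqrt (real q) * sqrt (real q)" by simp
      finally show ?thesis by (simp add: f_def algebra_simps)
    qed
  next
    fix z :: "nat \<Rightarrow> real" and \<nu> i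
    assume z0: "(\<Sum>j<n. z j) = 0" and ev: "\<And>i. i < n \<Longrightarrow> (\<Sum>j<n. A $$ (i, j) * z j) = \<nu> * z i"
      and i: "i < n" "z i \<noteq> 0"
    have ev': "(\<Sum>j<n. a i j * z j) = \<nu> * z i" if "i < n" for i
    proof -
      have "(\<Sum>j<n. a i j * z j) = (\<Sum>j<n. A $$ (i, j) * z j)" using that by (intro sum.cong) (auto simp: Aa)
      then show ?thesis using ev[OF that] by simp
    qed
    \<comment> \<open>The squared norm of \<open>A z\<close> is computed in two ways, from the
      eigenvalue equation and from \<open>A\<^sup>2 = c\<close>. The term with \<open>J\<close>
      vanishes because \<open>z\<close> sums to zero, and the terms with \<open>R\<close> and
      \<open>S\<close> only decrease the value.\<close>
    have "\<nu>\<^sup>2 * (\<Sum>i<n. z i * z i) = (\<Sum>i<n. (\<Sum>j<n. a i j * z j) * (\<Sum>k<n. a i k * z k))"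
      by (auto simp: sum_distrib_left ev' power2_eq_square intro!: sum.cong)
    also have "\<dots> = (\<Sum>i<n. \<Sum>j<n. \<Sum>k<n. a j i * a k i * (z j * z k))"
      unfolding sum_product by (intro sum.cong refl) (use a_sym in \<open>auto simp: mult_ac\<close>)
    also have "\<dots> = (\<Sum>j<n. \<Sum>i<n. \<Sum>k<n. a j i * a k i * (z j * z k))"
      by (rule sum.swap)
    also have "\<dots> = (\<Sum>j<n. \<Sum>k<n. \<Sum>i<n. a j i * a k i * (z j * z k))"
      by (intro sum.cong refl sum.swap)
    also have "\<dots> = (\<Sum>j<n. z j * (\<Sum>k<n. c j k * z k))"
      by (auto simp: sq[symmetric] sum_distrib_left sum_distrib_right mult_ac intro!: sum.cong)
    also have "\<dots> = real q * (\<Sum>j<n. z j * z j)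
        - real t * (\<Sum>j<n. \<Sum>k<n. of_bool (r j = r k) * (z j * z k)) - (\<Sum>j<n. \<Sum>k<n. of_bool (s j = s k) * (z j * z k))"
    proof -
      have "(\<Sum>j<n. z j * (\<Sum>k<n. c j k * z k)) = (\<Sum>j<n. real q * (z j * z j)
          - real t * (\<Sum>k<n. of_bool (r j = r k) * (z j * z k)) - (\<Sum>k<n. of_bool (s j = s k) * (z j * z k)))"
      proof (intro sum.cong refl)
        fix j assume "j \<in> {..<n}"
        then have "(\<Sum>k<n. c j k * z k) = real q * z j
            - real t * (\<Sum>k<n. of_bool (r j = r k) * z k) - (\<Sum>k<n. of_bool (s j = s k) * z k)"
          by (simp add: c_apply z0 del: sum_of_bool_mult_eq)
        then show "z j * (\<Sum>k<n. c j k * z k) = real q * (z j * z j)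
            - real t * (\<Sum>k<n. of_bool (r j = r k) * (z j * z k)) - (\<Sum>k<n. of_bool (s j = s k) * (z j * z k))"
          by (simp only: right_diff_distrib sum_distrib_left mult.left_commute[of "z j"] mult_ac)
      qed
      then show ?thesis by (simp add: sum_subtractf sum_distrib_left)
    qed
    also have "\<dots> \<le> real q * (\<Sum>j<n. z j * z j)"
    proof -
      have "0 \<le> real t * (\<Sum>j<n. \<Sum>k<n. of_bool (r j = r k) * (z j * z k))"
        by (intro mult_nonneg_nonneg class_sum_nonneg) auto
      moreover have "0 \<le> (\<Sum>j<n. \<Sum>k<n. of_bool (s j = s k) * (z j * z k))"
        by (intro class_sum_nonneg) auto
      ultimately show ?thesis by linarith
    qed
    finally have "\<nu>\<^sup>2 * (\<Sum>j<n. z j * z j) \<le> real q * (\<Sum>j<n. z j * z j)" .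
    moreover have "0 < (\<Sum>j<n. z j * z j)"
      using i by (intro sum_pos2[of _ i]) (auto simp: zero_less_mult_iff)
    ultimately have "\<nu>\<^sup>2 \<le> real q" by simp
    then show "\<nu> \<le> sqrt (real q)" by (rule real_le_rsqrt)
  qed
qed

text \<open>All claims follow from the common neighbour counts. The diagonal counts are the degrees,
  and two distinct vertices have at most \<open>t\<close> common neighbours. The abstract vertex set
  is transported to an initial segment of the natural numbers, which supplies the linear order for
  the adjacency matrix. The rectangle is asked for under \<open>t < q - 1\<close> only, since for
  larger \<open>t\<close> one direction of the constructed grids has a single class.\<close>

lemma graph_of_common_counts:
  fixes E :: "'v \<Rightarrow> 'v \<Rightarrow> bool" and V :: "'v set" and q t :: nat
  assumes fin: "finite V" and cardV: "card V * t = q * (q - 1)" and t: "0 < t" and q: "1 < q"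
    and sym: "\<And>u v. u \<in> V \<Longrightarrow> v \<in> V \<Longrightarrow> E u v \<Longrightarrow> E v u"
    and common: "\<And>u v. u \<in> V \<Longrightarrow> v \<in> V \<Longrightarrow> real (card {w \<in> V. E u w \<and> E v w}) =
        real q * of_bool (u = v) + real t - real t * of_bool (r u = r v) - of_bool (s u = s v)"
    and loop: "u0 \<in> V" "E u0 u0"
    and rect: "t < q - 1 \<Longrightarrow> \<exists>v\<in>V. \<exists>w\<in>V. \<exists>x\<in>V. r v = r u0 \<and> s v \<noteq> s u0 \<and> s w = s u0 \<and> r w \<noteq> r u0 \<and> r x = r w \<and> s x = s v"
  shows "\<exists>G :: (nat, nat \<times> nat) pre_digraph.
           pseudo_graph G \<and>
           real (card (verts G)) = real q * (real q - 1) / real t \<and>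
           nomulti_digraph G \<and> has_loop G \<and>
           regular_of_degree G (q - 1) \<and>
           complete_bipartite_free 2 (t + 1) G \<and>
           (t < q - 1 \<longrightarrow> second_largest_eigenvalue_is (adjacency_matrix G) (sqrt (real q)))"
proof -
  define n where "n = card V"
  obtain \<phi> where \<phi>: "bij_betw \<phi> {..<n} V"
    using ex_bij_betw_nat_finite[OF fin] unfolding n_def by (auto simp: lessThan_atLeast0)
  have \<phi>V: "\<phi> i \<in> V" if "i < n" for i using \<phi> that by (auto simp: bij_betw_def)
  have \<phi>_eq: "\<phi> i = \<phi> j \<longleftrightarrow> i = j" if "i < n" "j < n" for i j
    using \<phi> that by (auto simp: bij_betw_def inj_on_def)
  have \<phi>_surj: "\<exists>i<n. \<phi> i = v" if "v \<in> V" for v using \<phi> that by (auto simp: bij_betw_def)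
  define e where "e i j = E (\<phi> i) (\<phi> j)" for i j
  have e_common: "real (card {k. k < n \<and> e i k \<and> e j k}) =
      real q * of_bool (i = j) + real t - real t * of_bool (r (\<phi> i) = r (\<phi> j)) - of_bool (s (\<phi> i) = s (\<phi> j))"
    if "i < n" "j < n" for i j
  proof -
    have "bij_betw \<phi> {k. k < n \<and> e i k \<and> e j k} {w \<in> V. E (\<phi> i) w \<and> E (\<phi> j) w}"
      using \<phi> by (auto simp: bij_betw_def inj_on_def e_def)
    then have "card {k. k < n \<and> e i k \<and> e j k} = card {w \<in> V. E (\<phi> i) w \<and> E (\<phi> j) w}"
      by (rule bij_betw_same_card)
    then show ?thesis using common[OF \<phi>V \<phi>V] that by (simp add: \<phi>_eq)
  qed
  have e_sym: "e j i" if "i < n" "j < n" "e i j" for i j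
    using that sym \<phi>V unfolding e_def by blast
  \<comment> \<open>Each arc is its own pair of end points, so there are no parallel arcs, and a
    loop is the single arc \<open>(i, i)\<close>.\<close>
  define G :: "(nat, nat \<times> nat) pre_digraph" where
    "G = \<lparr>verts = {..<n}, arcs = {(i, j). i < n \<and> j < n \<and> e i j}, tail = fst, head = snd\<rparr>"
  have ends: "arcs_ends G = {(i, j). i < n \<and> j < n \<and> e i j}"
    by (auto simp: arcs_ends_conv G_def)
  have "arcs G \<subseteq> {..<n} \<times> {..<n}" by (auto simp: G_def)
  then have "finite (arcs G)" by (rule finite_subset) simp
  then have "pseudo_graph G"
    by unfold_locales (auto simp: G_def symmetric_def arcs_ends_conv sym_def intro: e_sym)
  moreover have "real (card (verts G)) = real q * (real q - 1) / real t"
  proof -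
    have "real n * real t = real q * real (q - 1)" using cardV by (simp add: n_def flip: of_nat_mult)
    then show ?thesis using t q by (simp add: G_def field_simps of_nat_diff)
  qed
  moreover have "nomulti_digraph G" by unfold_locales (auto simp: G_def arc_to_ends_def)
  moreover have "has_loop G"
    using \<phi>_surj[OF loop(1)] loop(2) by (auto simp: has_loop_def ends e_def) (auto simp: G_def)
  moreover have "regular_of_degree G (q - 1)"
    unfolding regular_of_degree_def
  proof
    fix i assume "i \<in> verts G"
    then have i: "i < n" by (simp add: G_def)
    \<comment> \<open>The repeated condition presents the neighbours of \<open>i\<close> as the
      common neighbours of \<open>i\<close> with itself, so that the diagonal count applies.\<close>
    have "out_arcs G i = Pair i ` {k. k < n \<and> e i k \<and> e i k}" using i by (auto simp: out_arcs_def G_def)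
    then have "out_degree G i = card {k. k < n \<and> e i k \<and> e i k}"
      by (simp add: out_degree_def card_image inj_on_def)
    then have "real (out_degree G i) = real q - 1" using e_common[OF i i] by simp
    then show "out_degree G i = q - 1" using q by linarith
  qed
  moreover have "complete_bipartite_free 2 (t + 1) G"
    unfolding complete_bipartite_free_def
  proof (rule notI, elim exE conjE)
    fix K assume sub: "subgraph K G" and K: "complete_bipartite_digraph 2 (t + 1) K"
    then obtain U W where UW: "card U = 2" "card W = t + 1" "arcs_ends K = U \<times> W \<union> W \<times> U"
      unfolding complete_bipartite_digraph_def by auto
    obtain i j where ij: "U = {i, j}" "i \<noteq> j" using UW(1) by (auto simp: card_2_iff)
    have "arcs_ends K \<subseteq> arcs_ends G"
      using sub unfolding subgraph_def compatible_def arcs_ends_conv by auto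
    then have "e i k \<and> e j k \<and> i < n \<and> j < n \<and> k < n" if "k \<in> W" for k
      using that unfolding UW(3) ends ij by blast
    \<comment> \<open>Some element of \<open>W\<close> must exist for its edges to show that
      \<open>i\<close> and \<open>j\<close> are vertices of \<open>G\<close>.\<close>
    moreover have "W \<noteq> {}" using UW(2) by auto
    ultimately have sub: "W \<subseteq> {k. k < n \<and> e i k \<and> e j k}" and "i < n" "j < n" by auto
    have "t + 1 \<le> card {k. k < n \<and> e i k \<and> e j k}"
      unfolding UW(2)[symmetric] by (rule card_mono[OF _ sub]) simp
    moreover have "real (card {k. k < n \<and> e i k \<and> e j k}) \<le> real t"
      using e_common[OF \<open>i < n\<close> \<open>j < n\<close>] ij(2) by (simp add: of_bool_def)
    ultimately show False by linarith
  qed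
  moreover have "second_largest_eigenvalue_is (adjacency_matrix G) (sqrt (real q))" if tq: "t < q - 1"
  proof -
    have "sorted_list_of_set {..<n} = [0..<n]"
      by (simp add: lessThan_atLeast0)
    then have adj: "adjacency_matrix G = mat n n (\<lambda>(i, j). if e i j then 1 else 0)"
      by (auto simp: adjacency_matrix_def Let_def G_def arcs_ends_conv intro!: eq_matI)
    obtain u where u: "u < n" "\<phi> u = u0" using \<phi>_surj loop by blast
    obtain v w x where "v < n" "w < n" "x < n" "r (\<phi> v) = r (\<phi> u)" "s (\<phi> v) \<noteq> s (\<phi> u)"
        "s (\<phi> w) = s (\<phi> u)" "r (\<phi> w) \<noteq> r (\<phi> u)" "r (\<phi> x) = r (\<phi> w)" "s (\<phi> x) = s (\<phi> v)"
      using rect[OF tq] \<phi>_surj u(2) by metis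
    then show ?thesis
      unfolding adj using e_sym e_common tq t u loop
      by (intro second_largest_eigenvalue_of_common_counts[where r = "\<lambda>i. r (\<phi> i)" and s = "\<lambda>i. s (\<phi> i)" and t = t
            and u = u and v = v and w = w and x = x]) (auto simp: e_def)
  qed
  ultimately show ?thesis by blast
qed

section \<open>Finite fields of prime power order\<close>

lemma (in cring) binomial_expansion:
  assumes x: "x \<in> carrier R" and y: "y \<in> carrier R"
  shows "(x \<oplus> y) [^] (n::nat) = (\<Oplus>k\<in>{..n}. add_pow R (n choose k) (x [^] k \<otimes> y [^] (n - k)))"
proof (induction n)
  case 0
  then show ?case using x y by simp
next
  case (Suc n)
  let ?t = "\<lambda>j k l. add_pow R (j::nat) (x [^] (k::nat) \<otimes> y [^] (l::nat))"
  have tc[simp]: "?t j k l \<in> carrier R" for j k l using x y by simp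
  have X: "x \<otimes> ?t j k l = ?t j (Suc k) l" for j k l
    using x y by (simp add: add_pow_rdistr nat_pow_Suc2 m_ac del: nat_pow_Suc)
  have Y: "y \<otimes> ?t j k l = ?t j k (Suc l)" for j k l
    using x y by (simp add: add_pow_rdistr m_ac)
  have "(x \<oplus> y) [^] Suc n = (x \<oplus> y) \<otimes> (\<Oplus>k\<in>{..n}. ?t (n choose k) k (n - k))"
    using x y Suc.IH by (simp add: m_comm)
  also have "\<dots> = (\<Oplus>k\<in>{..n}. ?t (n choose k) (Suc k) (n - k)) \<oplus> (\<Oplus>k\<in>{..n}. ?t (n choose k) k (Suc (n - k)))"
    using x y by (subst l_distr) (auto simp: finsum_rdistr X Y simp del: nat_pow_Suc)
  also have "(\<Oplus>k\<in>{..n}. ?t (n choose k) k (Suc (n - k))) = (\<Oplus>k\<in>{..n}. ?t (n choose k) k (Suc n - k))"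
    by (rule finsum_cong'[OF refl Pi_I[OF tc]]) (metis Suc_diff_le atMost_iff)
  \<comment> \<open>The new term \<open>k = Suc n\<close> has coefficient
    \<open>n choose Suc n = 0\<close>. Splitting off \<open>k = 0\<close> instead aligns the two
    sums for Pascal's rule.\<close>
  also have "\<dots> = (\<Oplus>k\<in>{..Suc n}. ?t (n choose k) k (Suc n - k))"
    using tc by (subst finsum_Suc) (auto simp: binomial_eq_0 finsum_closed simp del: nat_pow_Suc)
  also have "\<dots> = (\<Oplus>k\<in>{..n}. ?t (n choose Suc k) (Suc k) (n - k)) \<oplus> ?t 1 0 (Suc n)"
    by (subst finsum_Suc2) (auto simp del: nat_pow_Suc)
  also have "(\<Oplus>k\<in>{..n}. ?t (n choose k) (Suc k) (n - k)) \<oplus>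
      ((\<Oplus>k\<in>{..n}. ?t (n choose Suc k) (Suc k) (n - k)) \<oplus> ?t 1 0 (Suc n)) =
      (\<Oplus>k\<in>{..n}. ?t (Suc n choose Suc k) (Suc k) (n - k)) \<oplus> ?t 1 0 (Suc n)"
  proof -
    have "(\<Oplus>k\<in>{..n}. ?t (Suc n choose Suc k) (Suc k) (n - k)) =
        (\<Oplus>k\<in>{..n}. ?t (n choose k) (Suc k) (n - k) \<oplus> ?t (n choose Suc k) (Suc k) (n - k))"
      using x y by (intro finsum_cong') (auto simp: add.nat_pow_mult[symmetric] simp del: nat_pow_Suc)
    also have "\<dots> = (\<Oplus>k\<in>{..n}. ?t (n choose k) (Suc k) (n - k)) \<oplus> (\<Oplus>k\<in>{..n}. ?t (n choose Suc k) (Suc k) (n - k))"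
      by (rule finsum_addf[OF Pi_I[OF tc] Pi_I[OF tc]])
    finally show ?thesis using x y by (simp add: a_assoc finsum_closed Pi_def del: nat_pow_Suc)
  qed
  also have "\<dots> = (\<Oplus>k\<in>{..Suc n}. ?t (Suc n choose k) k (Suc n - k))"
    by (subst finsum_Suc2) (auto simp del: nat_pow_Suc)
  finally show ?case .
qed

lemma (in cring) add_pow_eq_zero_of_dvd:
  assumes "add_pow R p \<one> = \<zero>" and "p dvd (m::nat)" and x: "x \<in> carrier R"
  shows "add_pow R m x = \<zero>"
proof -
  obtain j where m: "m = p * j" using assms by blast
  have "add_pow R p x = \<zero>" using add_pow_ldistr[of \<one> x p] assms x by simp
  then show ?thesis using x add.nat_pow_pow[of x j p] by (simp add: m add.nat_pow_one)
qed

text \<open>For \<open>0 < k < p\<close> the prime \<open>p\<close> divides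
  \<open>p choose k\<close>, so only the two outer terms of the binomial expansion survive;
  iteration gives the powers of \<open>p\<close>. Stated for commutative rings, it serves both the
  algebraic closure and the polynomial ring over it.\<close>

lemma (in cring) frobenius_add:
  assumes p: "Factorial_Ring.prime (p::nat)" and char: "add_pow R p \<one> = \<zero>"
    and x: "x \<in> carrier R" and y: "y \<in> carrier R"
  shows "(x \<oplus> y) [^] (p ^ k) = x [^] (p ^ k) \<oplus> y [^] (p ^ k)"
proof (induction k)
  case 0
  then show ?case using x y by simp
next
  case (Suc k)
  have frob: "(a \<oplus> b) [^] p = a [^] p \<oplus> b [^] p" if a: "a \<in> carrier R" and b: "b \<in> carrier R" for a b
  proof -
    obtain r where r: "p = Suc r" and "r > 0" using prime_gt_1_nat[OF p] by (cases p) auto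
    let ?t = "\<lambda>k. add_pow R (p choose k) (a [^] k \<otimes> b [^] (p - k))"
    have zero: "?t k = \<zero>" if "0 < k" "k < p" for k
    proof (rule add_pow_eq_zero_of_dvd[OF char])
      show "p dvd p choose k" using that p by (intro dvd_choose_prime) auto
    qed (use a b in simp)
    have "(\<Oplus>k\<in>{..p}. ?t k) = ?t p \<oplus> (\<Oplus>k\<in>{..r}. ?t k)"
      unfolding r using a b by (subst finsum_Suc) (auto simp del: nat_pow_Suc binomial_Suc_Suc)
    also have "(\<Oplus>k\<in>{..r}. ?t k) = (\<Oplus>k\<in>{..r}. if 0 = k then b [^] p else \<zero>)"
      using a b zero r by (intro finsum_cong') auto
    also have "\<dots> = b [^] p"
      using b by (intro finsum_singleton[of 0 "{..r}" "\<lambda>_. b [^] p"]) auto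
    finally show ?thesis using a b by (simp add: binomial_expansion)
  qed
  have "(x \<oplus> y) [^] (p ^ Suc k) = ((x \<oplus> y) [^] (p ^ k)) [^] p"
    using x y by (simp add: nat_pow_pow mult.commute)
  also have "\<dots> = x [^] (p ^ Suc k) \<oplus> y [^] (p ^ Suc k)"
    using x y by (simp add: Suc.IH frob nat_pow_pow mult.commute)
  finally show ?case .
qed

text \<open>Additivity applied to \<open>\<ominus> x \<oplus> x = \<zero>\<close> avoids a case
  distinction on the parity of \<open>p\<close>.\<close>

lemma (in cring) frobenius_minus:
  assumes p: "Factorial_Ring.prime (p::nat)" and char: "add_pow R p \<one> = \<zero>" and x: "x \<in> carrier R"
  shows "(\<ominus> x) [^] (p ^ k) = \<ominus> (x [^] (p ^ k))"
proof -
  have "p ^ k \<noteq> 0" using p by (simp add: prime_gt_0_nat)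
  then have "(\<ominus> x) [^] (p ^ k) \<oplus> x [^] (p ^ k) = \<zero>"
    using frobenius_add[OF p char, of "\<ominus> x" x k] x by (simp add: l_neg nat_pow_zero)
  then show ?thesis using x by (metis a_inv_closed minus_equality nat_pow_closed)
qed

text \<open>This carries the characteristic from the prime field to its algebraic closure, and from
  there to the polynomial ring.\<close>

lemma ring_hom_add_pow_one:
  assumes "h \<in> ring_hom R S" "ring R" "ring S"
  shows "h (add_pow R (k::nat) \<one>\<^bsub>R\<^esub>) = add_pow S k \<one>\<^bsub>S\<^esub>"
proof -
  interpret R: ring R by fact
  interpret S: ring S by fact
  interpret ring_hom_ring R S h by (rule ring_hom_ringI2) fact+
  show ?thesis by (induction k) auto
qed


section \<open>Fixed points of the Frobenius map as roots of a polynomial\<close>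

lemma (in domain) monic_linear_eq:
  assumes "x \<in> carrier R"
  shows "[\<one>, x] = X \<oplus>\<^bsub>poly_ring R\<^esub> poly_of_const x"
  using assms by (auto simp: univ_poly_add var_def poly_of_const_def)

text \<open>
  With \<open>Y = X - a\<close> for a fixed point \<open>a\<close>, the Frobenius identity turns \<open>X ^ q - X\<close> into
  \<open>Y ^ q - Y = Y (Y ^ (q - 1) - 1)\<close>, whose second factor does not vanish at \<open>a\<close>; so all roots are simple.
\<close>

lemma (in algebraically_closed) card_frobenius_fixed:
  assumes p: "Factorial_Ring.prime (p::nat)" and char: "add_pow L p \<one> = \<zero>" and k: "0 < k"
  defines "K \<equiv> {x \<in> carrier L. x [^] (p ^ k) = x}"
  shows "finite K" "card K = p ^ k"
proof -
  let ?q = "p ^ k" and ?P = "poly_ring L"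
  interpret P: domain ?P by (rule univ_poly_is_domain[OF carrier_is_subring])
  have X: "X \<in> carrier ?P" by (rule var_closed[OF carrier_is_subring])
  have hom: "poly_of_const \<in> ring_hom L ?P"
    using canonical_embedding_is_hom[OF carrier_is_subring] by simp
  have q: "1 < ?q" using prime_gt_1_nat[OF p] k by (rule one_less_power)
  have charP: "add_pow ?P p \<one>\<^bsub>?P\<^esub> = \<zero>\<^bsub>?P\<^esub>"
  proof -
    have "poly_of_const (add_pow L p \<one>) = add_pow ?P p \<one>\<^bsub>?P\<^esub>"
      by (rule ring_hom_add_pow_one[OF hom ring_axioms P.ring_axioms])
    then show ?thesis by (simp add: char poly_of_const_def univ_poly_zero)
  qed
  define F where "F = X [^]\<^bsub>?P\<^esub> ?q \<ominus>\<^bsub>?P\<^esub> X"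
  have F: "F \<in> carrier ?P" using X by (simp add: F_def)
  have degF: "degree F = ?q"
  proof -
    have Xq: "X [^]\<^bsub>?P\<^esub> ?q = monom \<one> ?q" using unitary_monom_eq_var_pow[OF carrier_is_subring] by simp
    have m: "\<ominus>\<^bsub>?P\<^esub> X = [\<ominus> \<one>, \<zero>]"
    proof (rule P.minus_equality)
      show "[\<ominus> \<one>, \<zero>] \<oplus>\<^bsub>?P\<^esub> X = \<zero>\<^bsub>?P\<^esub>"
        by (simp add: univ_poly_add univ_poly_zero var_def l_neg)
      show "[\<ominus> \<one>, \<zero>] \<in> carrier ?P"
        by (auto simp: sym[OF univ_poly_carrier] polynomial_def)
    qed (rule X)
    have "polynomial (carrier L) (monom \<one> ?q)" "polynomial (carrier L) [\<ominus> \<one>, \<zero>]"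
      using P.nat_pow_closed[OF X, of ?q] P.a_inv_closed[OF X] unfolding Xq m univ_poly_carrier by auto
    note poly_add_degree_eq[OF carrier_is_subring this]
    moreover have "degree (monom \<one> ?q) = ?q" "degree [\<ominus> \<one>, \<zero>] = 1" by (simp_all add: monom_def)
    ultimately have "degree (poly_add (monom \<one> ?q) [\<ominus> \<one>, \<zero>]) = max ?q 1" using q by (metis less_not_refl)
    then show ?thesis using q by (simp add: F_def a_minus_def m Xq univ_poly_add del: poly_add.simps)
  qed
  have F0: "F \<noteq> []" using degF q by (metis diff_0_eq_0 less_nat_zero_code list.size(3))
  have ev: "eval F x = x [^] ?q \<ominus> x" if x: "x \<in> carrier L" for x
  proof -
    interpret ring_hom_ring ?P L "\<lambda>p. eval p x" by (rule eval_ring_hom[OF carrier_is_subring x])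
    show ?thesis using X x by (simp add: F_def a_minus_def hom_nat_pow eval_var)
  qed
  have root: "is_root F x \<longleftrightarrow> x \<in> K" for x
    using F0 ev by (auto simp: is_root_def K_def)
  have simple: "alg_mult F a \<le> 1" if a: "a \<in> K" for a
  proof (rule ccontr)
    assume "\<not> alg_mult F a \<le> 1"
    then have "2 \<le> alg_mult F a" by simp
    have aL: "a \<in> carrier L" and aq: "a [^] ?q = a" using a by (auto simp: K_def)
    interpret E: ring_hom_ring ?P L "\<lambda>p. eval p a" by (rule eval_ring_hom[OF carrier_is_subring aL])
    define c where "c = poly_of_const (\<ominus> a)"
    define Y where "Y = [\<one>, \<ominus> a]"
    have Y: "Y = X \<oplus>\<^bsub>?P\<^esub> c" unfolding Y_def c_def using aL by (intro monic_linear_eq) simp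
    have c: "c \<in> carrier ?P" using ring_hom_closed[OF hom] aL by (simp add: c_def)
    have Yc: "Y \<in> carrier ?P" unfolding Y using X c by simp
    have Y0: "Y \<noteq> \<zero>\<^bsub>?P\<^esub>" by (simp add: Y_def univ_poly_zero)
    have evY: "eval Y a = \<zero>" using aL by (simp add: Y_def r_neg)
    interpret H: ring_hom_ring L ?P poly_of_const
      using hom ring_axioms P.ring_axioms by (intro ring_hom_ringI2)
    have "c [^]\<^bsub>?P\<^esub> ?q = poly_of_const ((\<ominus> a) [^] ?q)" using aL by (simp add: c_def H.hom_nat_pow)
    \<comment> \<open>Since \<open>a\<close> is fixed by the Frobenius map, so is the constant
      polynomial \<open>c\<close>; replacing \<open>X\<close> by \<open>Y = X + c\<close> therefore
      leaves \<open>F\<close> unchanged.\<close>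
    then have cq: "c [^]\<^bsub>?P\<^esub> ?q = c" using aL frobenius_minus[OF p char aL, of k] by (simp add: aq c_def)
    have "F = Y [^]\<^bsub>?P\<^esub> ?q \<ominus>\<^bsub>?P\<^esub> Y"
      unfolding F_def Y using X c P.frobenius_add[OF p charP X c, of k]
      by (simp add: cq) (simp add: a_minus_def P.minus_add P.a_ac P.r_neg1 P.r_neg2)
    moreover have "Y [^]\<^bsub>?P\<^esub> ?q = Y \<otimes>\<^bsub>?P\<^esub> Y [^]\<^bsub>?P\<^esub> (?q - 1)"
    proof -
      have "Suc (?q - 1) = ?q" using q by linarith
      then show ?thesis using P.nat_pow_Suc2[OF Yc, of "?q - 1"] by (simp only:)
    qed
    ultimately have FY: "F = Y \<otimes>\<^bsub>?P\<^esub> (Y [^]\<^bsub>?P\<^esub> (?q - 1) \<ominus>\<^bsub>?P\<^esub> \<one>\<^bsub>?P\<^esub>)"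
      using Yc by (simp add: a_minus_def P.r_distr P.r_minus)
    have "Y [^]\<^bsub>?P\<^esub> (2::nat) pdivides F"
      unfolding Y_def by (rule le_alg_mult_imp_pdivides[OF aL F]) fact
    then obtain Q where Q: "Q \<in> carrier ?P" and "F = Y [^]\<^bsub>?P\<^esub> (2::nat) \<otimes>\<^bsub>?P\<^esub> Q"
      unfolding pdivides_def by (rule dividesE)
    then have "F = Y \<otimes>\<^bsub>?P\<^esub> (Y \<otimes>\<^bsub>?P\<^esub> Q)" using Yc by (simp add: numeral_2_eq_2 P.m_assoc)
    \<comment> \<open>If \<open>Y\<close> divided \<open>F\<close> twice, cancelling one factor and
      evaluating at \<open>a\<close> would give \<open>-1\<close> on the left and \<open>0\<close>
      on the right.\<close>
    then have "Y [^]\<^bsub>?P\<^esub> (?q - 1) \<ominus>\<^bsub>?P\<^esub> \<one>\<^bsub>?P\<^esub> = Y \<otimes>\<^bsub>?P\<^esub> Q"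
      using FY Yc Q Y0 P.m_lcancel[of Y "Y [^]\<^bsub>?P\<^esub> (?q - 1) \<ominus>\<^bsub>?P\<^esub> \<one>\<^bsub>?P\<^esub>" "Y \<otimes>\<^bsub>?P\<^esub> Q"] by simp
    then have "eval (Y [^]\<^bsub>?P\<^esub> (?q - 1) \<ominus>\<^bsub>?P\<^esub> \<one>\<^bsub>?P\<^esub>) a = eval (Y \<otimes>\<^bsub>?P\<^esub> Q) a" by simp
    then have "\<zero> [^] (?q - 1) \<ominus> \<one> = \<zero>"
      using Yc Q evY by (simp add: a_minus_def E.hom_nat_pow)
    moreover have "\<zero> [^] (?q - 1) = \<zero>" using q by (intro nat_pow_zero) linarith
    ultimately show False by simp
  qed
  have cnt: "count (roots F) x = (if x \<in> K then 1 else 0)" for x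
  proof (cases "x \<in> K")
    case True
    then have "0 < alg_mult F x" using alg_mult_gt_zero_iff_is_root[OF F, of x] root[of x] by blast
    then have "alg_mult F x = 1" using simple[OF True] by linarith
    then show ?thesis using True by (simp add: alg_mult_eq_count_roots[OF F])
  next
    case False
    then show ?thesis using roots_mem_iff_is_root[OF F, of x] root[of x] by (simp add: not_in_iff)
  qed
  have setK: "set_mset (roots F) = K" using roots_mem_iff_is_root[OF F] root by blast
  show "finite K" using setK by (metis finite_set_mset)
  \<comment> \<open>As every root is simple, the multiset of roots has as many elements as
    \<open>K\<close>; since \<open>F\<close> splits, this number is its degree.\<close>
  have "size (roots F) = card K"
    unfolding size_multiset_overloaded_eq setK using cnt by simp
  then show "card K = ?q" using roots_over_carrier[OF F] degF by (simp add: splitted_def)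
qed

text \<open>The fixed points of the \<open>q\<close>-th power map in the algebraic closure of the
  prime field form a subfield, and there are \<open>q\<close> of them by the previous lemma. The
  element type is that of \<open>alg_closure\<close> over a ring of integers.\<close>

lemma ex_field_of_primepow_order:
  assumes "primepow q"
  obtains F :: "((int list \<times> nat) multiset \<Rightarrow> int) ring" where "field F" "finite (carrier F)" "card (carrier F) = q"
proof -
  obtain p k where p: "Factorial_Ring.prime p" and k: "0 < k" and q: "q = p ^ k"
    using assms by (auto simp: primepow_def)
  define R where "R = residue_ring (int p)"
  interpret R: residues_prime p R
    using p by unfold_locales (simp_all add: R_def)
  define L where "L = R.alg_closure"
  have "algebraic_closure L (R.indexed_const ` carrier R)" and h: "R.indexed_const \<in> ring_hom R L"
    unfolding L_def by (rule R.alg_closureE)+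
  then interpret L: algebraic_closure L "R.indexed_const ` carrier R" by blast
  have "add_pow R m \<one>\<^bsub>R\<^esub> = int m mod int p" for m
    by (induction m) (simp_all add: R.res_add_eq R.res_one_eq R.res_zero_eq mod_simps add.commute)
  then have "add_pow R p \<one>\<^bsub>R\<^esub> = \<zero>\<^bsub>R\<^esub>" by (simp add: R.res_zero_eq)
  then have char: "add_pow L p \<one>\<^bsub>L\<^esub> = \<zero>\<^bsub>L\<^esub>"
    using ring_hom_add_pow_one[OF h R.ring_axioms L.ring_axioms, of p]
      ring_hom_zero[OF h R.ring_axioms L.ring_axioms] by simp
  define K where "K = {x \<in> carrier L. x [^]\<^bsub>L\<^esub> (p ^ k) = x}"
  have K: "finite K" "card K = q"
    unfolding K_def q by (rule L.card_frobenius_fixed[OF p char k])+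
  have q0: "p ^ k \<noteq> 0" using p by (simp add: prime_gt_0_nat)
  have "subfield K L"
  proof (rule L.subfieldI'[OF L.subringI])
    show "inv\<^bsub>L\<^esub> x \<in> K" if "x \<in> K - {\<zero>\<^bsub>L\<^esub>}" for x
    proof -
      have x: "x \<in> Units L" using that by (auto simp: K_def L.field_Units)
      have xq: "x [^]\<^bsub>L\<^esub> (p ^ k) = x" using that by (simp add: K_def)
      have "(x \<otimes>\<^bsub>L\<^esub> inv\<^bsub>L\<^esub> x) [^]\<^bsub>L\<^esub> (p ^ k) = x \<otimes>\<^bsub>L\<^esub> (inv\<^bsub>L\<^esub> x) [^]\<^bsub>L\<^esub> (p ^ k)"
        using x by (subst L.nat_pow_distrib) (auto simp: xq)
      then have "(inv\<^bsub>L\<^esub> x) [^]\<^bsub>L\<^esub> (p ^ k) = inv\<^bsub>L\<^esub> x"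
        using x L.comm_inv_char[of x "(inv\<^bsub>L\<^esub> x) [^]\<^bsub>L\<^esub> (p ^ k)"] by (simp add: L.Units_closed)
      then show ?thesis using x by (simp add: K_def)
    qed
  qed (auto simp: K_def L.frobenius_minus[OF p char] L.frobenius_add[OF p char] L.nat_pow_distrib)
  then have "field (L\<lparr>carrier := K\<rparr>)" by (rule L.subfield_iff)
  then show ?thesis using that[of "L\<lparr>carrier := K\<rparr>"] K by simp
qed

section \<open>The two constructions\<close>

text \<open>The fibres of the quotient map are the cosets of \<open>H\<close>, all of the same size.
  The lemma is applied to the additive group and to the unit group of the field.\<close>

lemma (in comm_group) quotient_hom:
  assumes H: "subgroup H G" and fin: "finite (carrier G)"
  shows "comm_group (G Mod H)" "(#>) H \<in> hom G (G Mod H)"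
    and "m \<in> carrier (G Mod H) \<Longrightarrow> card {a \<in> carrier G. H #> a = m} = card H"
    and "card (carrier (G Mod H)) * card H = card (carrier G)"
proof -
  show "comm_group (G Mod H)" by (rule abelian_FactGroup[OF H])
  interpret normal H G using H by (rule subgroup_imp_normal)
  show "(#>) H \<in> hom G (G Mod H)" by (rule r_coset_hom_Mod)
  show "card (carrier (G Mod H)) * card H = card (carrier G)"
    using lagrange[OF H] by (simp add: FactGroup_def order_def)
  assume "m \<in> carrier (G Mod H)"
  then obtain b where b: "b \<in> carrier G" "m = H #> b" by (auto simp: carrier_FactGroup)
  have "{a \<in> carrier G. H #> a = m} = H #> b"
  proof (intro subset_antisym subsetI)
    show "a \<in> H #> b" if "a \<in> {a \<in> carrier G. H #> a = m}" for a
      using that b rcos_self[OF _ H, of a] by auto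
    show "a \<in> {a \<in> carrier G. H #> a = m}" if "a \<in> H #> b" for a
      using that b H repr_independence[OF that] r_coset_subset_G[OF subset b(1)] by auto
  qed
  moreover have "card (H #> b) = card H"
    using b H by (intro card_rcosets_equal[symmetric]) (auto simp: RCOSETS_def subset)
  ultimately show "card {a \<in> carrier G. H #> a = m} = card H" by simp
qed

text \<open>For fixed nonzero \<open>d\<close>, sending \<open>e\<close> to \<open>d / e\<close> is
  an involution of the nonzero elements; the substitution in the multiplicative construction rests
  on it.\<close>

lemma (in field) nonzero_divide:
  assumes "d \<in> carrier R" "d \<noteq> \<zero>" "e \<in> carrier R" "e \<noteq> \<zero>"
  shows "d \<otimes> inv e \<in> carrier R" "d \<otimes> inv e \<noteq> \<zero>" "d \<otimes> inv e \<otimes> e = d" "d \<otimes> inv (d \<otimes> inv e) = e"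
proof -
  have u: "d \<in> Units R" "e \<in> Units R" using assms by (auto simp: field_Units)
  then have de: "d \<otimes> inv e \<in> Units R" by simp
  then show "d \<otimes> inv e \<in> carrier R" "d \<otimes> inv e \<noteq> \<zero>" by (auto simp: field_Units)
  have *: "d \<otimes> inv e \<otimes> e = d" using u by (simp add: m_assoc Units_closed)
  then show "d \<otimes> inv e \<otimes> e = d" .
  have "d \<otimes> inv (d \<otimes> inv e) = e \<otimes> (d \<otimes> inv e) \<otimes> inv (d \<otimes> inv e)"
    using * u de by (simp add: m_comm Units_closed)
  also have "\<dots> = e" using u de by (simp add: m_assoc Units_closed)
  finally show "d \<otimes> inv (d \<otimes> inv e) = e" .
qed

text \<open>For \<open>x = y\<close> the two adjacency conditions on \<open>(c, z)\<close>
  contradict each other unless \<open>a = b\<close>, and then \<open>c\<close> is determined by the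
  nonzero value \<open>x + z + 1\<close>. For \<open>x \<noteq> y\<close> dividing the conditions
  eliminates \<open>c\<close> and leaves a ratio in a fibre of \<open>l\<close>.\<close>

lemma (in field) ex_graph_multiplicative:
  fixes M :: "'c monoid" and q t :: nat
  assumes fin: "finite (carrier R)" and q: "card (carrier R) = q" and t: "0 < t"
    and M: "comm_group M" and l: "l \<in> hom (Multiplicative_Group.mult_of R) M"
    and fiber: "\<And>m. m \<in> carrier M \<Longrightarrow> card {a \<in> carrier (Multiplicative_Group.mult_of R). l a = m} = t"
    and cardM: "card (carrier M) * t = card (carrier (Multiplicative_Group.mult_of R))"
  shows "\<exists>G :: (nat, nat \<times> nat) pre_digraph.
           pseudo_graph G \<and>
           real (card (verts G)) = real q * (real q - 1) / real t \<and>
           nomulti_digraph G \<and> has_loop G \<and>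
           regular_of_degree G (q - 1) \<and>
           complete_bipartite_free 2 (t + 1) G \<and>
           (t < q - 1 \<longrightarrow> second_largest_eigenvalue_is (adjacency_matrix G) (sqrt (real q)))"
proof -
  interpret M: comm_group M by (rule M)
  interpret l: group_hom "Multiplicative_Group.mult_of R" M l
    unfolding group_hom_def group_hom_axioms_def using field_mult_group l M.group_axioms by blast
  have l_closed[simp]: "l x \<in> carrier M" if "x \<in> carrier R" "x \<noteq> \<zero>" for x
    using l.hom_closed[of x] that by simp
  have l_mult: "l (x \<otimes> y) = l x \<otimes>\<^bsub>M\<^esub> l y" if "x \<in> carrier R" "x \<noteq> \<zero>" "y \<in> carrier R" "y \<noteq> \<zero>" for x y
    using l.hom_mult[of x y] that by simp
  have l_one: "l \<one> = \<one>\<^bsub>M\<^esub>" using l.hom_one by simp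
  have cardU: "card (carrier R - {\<zero>}) = q - 1" using q fin by simp
  have q1: "1 < q"
    using card_mono[OF fin, of "{\<zero>, \<one>}"] q by simp
  have finM: "finite (carrier M)"
    using cardM cardU q1 by (intro card_ge_0_finite) (cases "card (carrier M)"; simp)
  define V where "V = carrier M \<times> carrier R"
  \<comment> \<open>The homomorphism \<open>l\<close> is meaningful on units only, hence the
    explicit condition that the sum is nonzero.\<close>
  define E where "E u v \<longleftrightarrow> snd u \<oplus> snd v \<oplus> \<one> \<noteq> \<zero> \<and> l (snd u \<oplus> snd v \<oplus> \<one>) = fst u \<otimes>\<^bsub>M\<^esub> fst v" for u v
  have common: "real (card {w \<in> V. E (a, x) w \<and> E (b, y) w}) =
      real q * of_bool ((a, x) = (b, y)) + real t - real t * of_bool (x = y) - of_bool (a = b)"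
    if ax: "a \<in> carrier M" "x \<in> carrier R" and bx: "b \<in> carrier M" "y \<in> carrier R" for a b x y
  proof -
    define W where "W = {w \<in> V. E (a, x) w \<and> E (b, y) w}"
    have W: "(c, z) \<in> W \<longleftrightarrow> c \<in> carrier M \<and> z \<in> carrier R \<and> x \<oplus> z \<oplus> \<one> \<noteq> \<zero> \<and> y \<oplus> z \<oplus> \<one> \<noteq> \<zero> \<and>
        l (x \<oplus> z \<oplus> \<one>) = a \<otimes>\<^bsub>M\<^esub> c \<and> l (y \<oplus> z \<oplus> \<one>) = b \<otimes>\<^bsub>M\<^esub> c" for c z
      by (auto simp: W_def V_def E_def)
    have shift: "v \<ominus> (x' \<oplus> \<one>) \<in> carrier R" "x' \<oplus> (v \<ominus> (x' \<oplus> \<one>)) \<oplus> \<one> = v" "x' \<oplus> v \<oplus> \<one> \<ominus> (x' \<oplus> \<one>) = v"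
      if "v \<in> carrier R" "x' \<in> carrier R" for v x'
      using that by (simp, algebra, algebra)
    have solve: "c = inv\<^bsub>M\<^esub> b' \<otimes>\<^bsub>M\<^esub> m \<longleftrightarrow> m = b' \<otimes>\<^bsub>M\<^esub> c" if "c \<in> carrier M" "b' \<in> carrier M" "m \<in> carrier M" for c b' m
      using that M.inv_solve_left[of c b' m] by auto
    consider "x = y" "a = b" | "x = y" "a \<noteq> b" | "x \<noteq> y" by blast
    then show ?thesis
    proof cases
      case 1
      have "bij_betw (\<lambda>(c, z). x \<oplus> z \<oplus> \<one>) W (carrier R - {\<zero>})"
      proof (rule bij_betwI[where g = "\<lambda>v. (inv\<^bsub>M\<^esub> a \<otimes>\<^bsub>M\<^esub> l v, v \<ominus> (x \<oplus> \<one>))"])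
        show "(\<lambda>v. (inv\<^bsub>M\<^esub> a \<otimes>\<^bsub>M\<^esub> l v, v \<ominus> (x \<oplus> \<one>))) \<in> carrier R - {\<zero>} \<rightarrow> W"
          using ax 1 by (auto simp: W shift M.m_assoc[symmetric])
      qed (use ax 1 in \<open>auto simp: W shift M.m_assoc[symmetric]\<close>)
      then have "card W = q - 1" using bij_betw_same_card cardU by metis
      then show ?thesis using 1 q1 unfolding W_def[symmetric] by (simp add: of_nat_diff)
    next
      case 2
      have "W = {}" using 2 ax bx by (auto simp: W)
      then show ?thesis using 2 unfolding W_def[symmetric] by simp
    next
      case 3
      define d where "d = x \<ominus> y"
      have d: "d \<in> carrier R" "d \<noteq> \<zero>" using 3 ax bx by (auto simp: d_def)
      have xd: "x \<oplus> z \<oplus> \<one> = (y \<oplus> z \<oplus> \<one>) \<oplus> d" if "z \<in> carrier R" for z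
        unfolding d_def using that ax bx by algebra
      define S where "S = {w \<in> carrier (Multiplicative_Group.mult_of R). l w = a \<otimes>\<^bsub>M\<^esub> inv\<^bsub>M\<^esub> b}"
      \<comment> \<open>A common neighbour \<open>(c, z)\<close> corresponds to the ratio \<open>w = (x + z + 1) / (y + z + 1)\<close>, and then
        \<open>y + z + 1 = d / (w - 1)\<close>.\<close>
      define v where "v w = d \<otimes> inv (w \<ominus> \<one>)" for w
      have vw: "v w \<in> carrier R" "v w \<noteq> \<zero>" "d \<otimes> inv (v w) = w \<ominus> \<one>" "w \<otimes> v w = v w \<oplus> d"
        if "w \<in> carrier R" "w \<noteq> \<one>" for w
      proof -
        have w1: "w \<ominus> \<one> \<in> carrier R" "w \<ominus> \<one> \<noteq> \<zero>" using that by auto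
        show "v w \<in> carrier R" "v w \<noteq> \<zero>" "d \<otimes> inv (v w) = w \<ominus> \<one>"
          unfolding v_def using nonzero_divide[OF d w1] by auto
        have "v w \<otimes> (w \<ominus> \<one>) = d" unfolding v_def using nonzero_divide[OF d w1] by auto
        moreover have "w \<otimes> v w = v w \<oplus> v w \<otimes> (w \<ominus> \<one>)" using \<open>v w \<in> carrier R\<close> that(1) by algebra
        ultimately show "w \<otimes> v w = v w \<oplus> d" by simp
      qed
      have "bij_betw (\<lambda>(c, z). \<one> \<oplus> d \<otimes> inv (y \<oplus> z \<oplus> \<one>)) W (S - {\<one>})"
      proof (rule bij_betwI[where g = "\<lambda>w. (inv\<^bsub>M\<^esub> b \<otimes>\<^bsub>M\<^esub> l (v w), v w \<ominus> (y \<oplus> \<one>))"])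
        show "(\<lambda>(c, z). \<one> \<oplus> d \<otimes> inv (y \<oplus> z \<oplus> \<one>)) \<in> W \<rightarrow> S - {\<one>}"
        proof (clarsimp simp only: split_paired_all Pi_iff W prod.case)
          fix c z
          define v' where "v' = y \<oplus> z \<oplus> \<one>"
          define w where "w = \<one> \<oplus> d \<otimes> inv v'"
          assume cz: "c \<in> carrier M" "z \<in> carrier R" "x \<oplus> z \<oplus> \<one> \<noteq> \<zero>" "y \<oplus> z \<oplus> \<one> \<noteq> \<zero>"
            "l (x \<oplus> z \<oplus> \<one>) = a \<otimes>\<^bsub>M\<^esub> c" "l (y \<oplus> z \<oplus> \<one>) = b \<otimes>\<^bsub>M\<^esub> c"
          have v': "v' \<in> carrier R" "v' \<noteq> \<zero>" using cz bx by (auto simp: v'_def)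
          note dv = nonzero_divide[OF d v']
          have w: "w \<in> carrier R" using dv by (simp add: w_def)
          have wv: "w \<otimes> v' = x \<oplus> z \<oplus> \<one>"
            using dv v' d cz by (simp add: w_def l_distr xd v'_def[symmetric])
          then have w0: "w \<noteq> \<zero>" using cz v' by auto
          have "w \<noteq> \<one>"
          proof
            assume "w = \<one>"
            then have "v' \<oplus> \<zero> = v' \<oplus> d" using wv v' xd[OF cz(2)] by (simp add: v'_def)
            then show False using v' d by (simp del: r_zero)
          qed
          moreover have "l w \<otimes>\<^bsub>M\<^esub> (b \<otimes>\<^bsub>M\<^esub> c) = a \<otimes>\<^bsub>M\<^esub> c"
            using l_mult[OF w w0 v'] cz(5,6) unfolding wv by (simp add: v'_def)
          then have "l w \<otimes>\<^bsub>M\<^esub> b = a"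
            using w w0 cz ax bx by (simp add: M.m_assoc[symmetric])
          then have "l w = a \<otimes>\<^bsub>M\<^esub> inv\<^bsub>M\<^esub> b"
            using w w0 ax bx M.inv_solve_right[of "l w" a b] by auto
          ultimately show "\<one> \<oplus> d \<otimes> inv (y \<oplus> z \<oplus> \<one>) \<in> S - {\<one>}"
            using w w0 by (simp add: S_def w_def v'_def)
        qed
        show "(\<lambda>w. (inv\<^bsub>M\<^esub> b \<otimes>\<^bsub>M\<^esub> l (v w), v w \<ominus> (y \<oplus> \<one>))) \<in> S - {\<one>} \<rightarrow> W"
        proof
          fix w assume "w \<in> S - {\<one>}"
          then have w: "w \<in> carrier R" "w \<noteq> \<zero>" "w \<noteq> \<one>" "l w = a \<otimes>\<^bsub>M\<^esub> inv\<^bsub>M\<^esub> b" by (auto simp: S_def)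
          note v = vw[OF w(1,3)]
          have z: "v w \<ominus> (y \<oplus> \<one>) \<in> carrier R" "y \<oplus> (v w \<ominus> (y \<oplus> \<one>)) \<oplus> \<one> = v w"
            using shift v bx by auto
          then have xz: "x \<oplus> (v w \<ominus> (y \<oplus> \<one>)) \<oplus> \<one> = w \<otimes> v w" using xd v by simp
          have "w \<otimes> v w \<noteq> \<zero>" using v(1,2) w(1,2) by (simp add: integral_iff)
          moreover have "l (w \<otimes> v w) = a \<otimes>\<^bsub>M\<^esub> (inv\<^bsub>M\<^esub> b \<otimes>\<^bsub>M\<^esub> l (v w))"
            using l_mult[OF w(1,2) v(1,2)] v(1,2) w(4) ax bx by (simp only:) (simp add: M.m_assoc)
          moreover have "l (v w) = b \<otimes>\<^bsub>M\<^esub> (inv\<^bsub>M\<^esub> b \<otimes>\<^bsub>M\<^esub> l (v w))"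
            using v bx by (simp add: M.m_assoc[symmetric])
          ultimately show "(inv\<^bsub>M\<^esub> b \<otimes>\<^bsub>M\<^esub> l (v w), v w \<ominus> (y \<oplus> \<one>)) \<in> W"
            unfolding W xz z(2) using v z(1) bx by simp
        qed
        show "(inv\<^bsub>M\<^esub> b \<otimes>\<^bsub>M\<^esub> l (v ((\<lambda>(c, z). \<one> \<oplus> d \<otimes> inv (y \<oplus> z \<oplus> \<one>)) cz)),
            v ((\<lambda>(c, z). \<one> \<oplus> d \<otimes> inv (y \<oplus> z \<oplus> \<one>)) cz) \<ominus> (y \<oplus> \<one>)) = cz" if "cz \<in> W" for cz
        proof -
          obtain c z where [simp]: "cz = (c, z)" by (cases cz)
          have cz: "c \<in> carrier M" "z \<in> carrier R" "y \<oplus> z \<oplus> \<one> \<noteq> \<zero>" "l (y \<oplus> z \<oplus> \<one>) = b \<otimes>\<^bsub>M\<^esub> c"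
            using that by (auto simp: W)
          have v': "y \<oplus> z \<oplus> \<one> \<in> carrier R" using cz bx by simp
          note dv = nonzero_divide[OF d v' cz(3)]
          have "\<one> \<oplus> d \<otimes> inv (y \<oplus> z \<oplus> \<one>) \<ominus> \<one> = d \<otimes> inv (y \<oplus> z \<oplus> \<one>)"
            using dv(1) by algebra
          then have "v (\<one> \<oplus> d \<otimes> inv (y \<oplus> z \<oplus> \<one>)) = y \<oplus> z \<oplus> \<one>" using dv by (simp add: v_def)
          then show ?thesis using cz bx by (simp add: shift M.m_assoc[symmetric])
        qed
        show "(\<lambda>(c, z). \<one> \<oplus> d \<otimes> inv (y \<oplus> z \<oplus> \<one>)) (inv\<^bsub>M\<^esub> b \<otimes>\<^bsub>M\<^esub> l (v w), v w \<ominus> (y \<oplus> \<one>)) = w"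
          if "w \<in> S - {\<one>}" for w
        proof -
          have w: "w \<in> carrier R" "w \<noteq> \<one>" using that by (auto simp: S_def)
          have "\<one> \<oplus> (w \<ominus> \<one>) = w" using w(1) by algebra
          then show ?thesis using vw[OF w] bx by (simp add: shift)
        qed
      qed
      then have "card W = card (S - {\<one>})" by (rule bij_betw_same_card)
      moreover have "card S = t" unfolding S_def using ax bx by (intro fiber) simp
      \<comment> \<open>The ratio \<open>\<one>\<close> cannot occur, as it would force
        \<open>d = \<zero>\<close>. Removing it from the fibre costs one exactly when
        \<open>a = b\<close>, which is the last term of the count.\<close>
      moreover have "\<one> \<in> S \<longleftrightarrow> a = b"
        using ax bx M.inv_solve_right[of "\<one>\<^bsub>M\<^esub>" a b] by (auto simp: S_def l_one)
      ultimately have "real (card W) = real t - of_bool (a = b)"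
        using t by (simp add: card_Diff_singleton_if of_nat_diff)
      then show ?thesis using 3 unfolding W_def[symmetric] by simp
    qed
  qed
  show ?thesis
  proof (rule graph_of_common_counts[where V = V and E = E and r = snd and s = fst and ?u0.0 = "(\<one>\<^bsub>M\<^esub>, \<zero>)"])
    show "finite V" using fin finM by (simp add: V_def)
    show "card V * t = q * (q - 1)" using cardM cardU q by (simp add: V_def card_cartesian_product)
    show "E v u" if "u \<in> V" "v \<in> V" "E u v" for u v
      using that by (auto simp: E_def V_def a_comm M.m_comm)
    show "real (card {w \<in> V. E u w \<and> E v w}) =
        real q * of_bool (u = v) + real t - real t * of_bool (snd u = snd v) - of_bool (fst u = fst v)"
      if "u \<in> V" "v \<in> V" for u v
      using common[of "fst u" "snd u" "fst v" "snd v"] that by (auto simp: V_def)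
    show "E (\<one>\<^bsub>M\<^esub>, \<zero>) (\<one>\<^bsub>M\<^esub>, \<zero>)" by (simp add: E_def l_one)
    assume "t < q - 1"
    \<comment> \<open>A trivial \<open>M\<close> would mean \<open>t = q - 1\<close>. A second class
      \<open>b\<close> gives the corners \<open>(b, \<zero>)\<close>,
      \<open>(\<one>, \<one>)\<close> and \<open>(b, \<one>)\<close>.\<close>
    then have "card (carrier M) \<noteq> 1" using cardM cardU by auto
    then obtain b where b: "b \<in> carrier M" "b \<noteq> \<one>\<^bsub>M\<^esub>"
      by (metis M.one_closed is_singletonI' is_singleton_altdef empty_iff)
    then show "\<exists>v\<in>V. \<exists>w\<in>V. \<exists>x\<in>V. snd v = snd (\<one>\<^bsub>M\<^esub>, \<zero>) \<and> fst v \<noteq> fst (\<one>\<^bsub>M\<^esub>, \<zero>) \<and>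
        fst w = fst (\<one>\<^bsub>M\<^esub>, \<zero>) \<and> snd w \<noteq> snd (\<one>\<^bsub>M\<^esub>, \<zero>) \<and> snd x = snd w \<and> fst x = fst v"
      by (intro bexI[of _ "(b, \<zero>)"] bexI[of _ "(\<one>\<^bsub>M\<^esub>, \<one>)"] bexI[of _ "(b, \<one>)"]) (auto simp: V_def)
  qed (use t q1 in \<open>auto simp: V_def\<close>)
qed

text \<open>The roles of the two operations are exchanged. For \<open>a \<noteq> b\<close> the
  difference of the two adjacency conditions eliminates \<open>z\<close> and leaves
  \<open>e = (a - b) c\<close> in a fibre of \<open>\<pi>\<close>; the excluded value
  \<open>e = \<zero>\<close> lies in that fibre exactly when \<open>x = y\<close>. The group
  \<open>N\<close> is written multiplicatively although it stands for an additive quotient.\<close>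

lemma (in field) ex_graph_additive:
  fixes N :: "'c monoid" and q t :: nat
  assumes fin: "finite (carrier R)" and q: "card (carrier R) = q" and t: "0 < t"
    and N: "comm_group N" and \<pi>: "\<pi> \<in> hom (add_monoid R) N"
    and fiber: "\<And>m. m \<in> carrier N \<Longrightarrow> card {a \<in> carrier R. \<pi> a = m} = t"
    and cardN: "card (carrier N) * t = q"
  shows "\<exists>G :: (nat, nat \<times> nat) pre_digraph.
           pseudo_graph G \<and>
           real (card (verts G)) = real q * (real q - 1) / real t \<and>
           nomulti_digraph G \<and> has_loop G \<and>
           regular_of_degree G (q - 1) \<and>
           complete_bipartite_free 2 (t + 1) G \<and>
           (t < q - 1 \<longrightarrow> second_largest_eigenvalue_is (adjacency_matrix G) (sqrt (real q)))"
proof -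
  interpret N: comm_group N by (rule N)
  interpret \<pi>: group_hom "add_monoid R" N \<pi>
    unfolding group_hom_def group_hom_axioms_def using add.group_axioms \<pi> N.group_axioms by blast
  have \<pi>_closed[simp]: "\<pi> x \<in> carrier N" if "x \<in> carrier R" for x
    using \<pi>.hom_closed[of x] that by simp
  have \<pi>_add: "\<pi> (x \<oplus> y) = \<pi> x \<otimes>\<^bsub>N\<^esub> \<pi> y" if "x \<in> carrier R" "y \<in> carrier R" for x y
    using \<pi>.hom_mult[of x y] that by simp
  have \<pi>_zero: "\<pi> \<zero> = \<one>\<^bsub>N\<^esub>" using \<pi>.hom_one by simp
  have cardU: "card (carrier R - {\<zero>}) = q - 1" using q fin by simp
  have q1: "1 < q"
    using card_mono[OF fin, of "{\<zero>, \<one>}"] q by simp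
  have finN: "finite (carrier N)"
    using cardN q1 by (intro card_ge_0_finite) (cases "card (carrier N)"; simp)
  define V where "V = (carrier R - {\<zero>}) \<times> carrier N"
  define E where "E u v \<longleftrightarrow> \<pi> (fst u \<otimes> fst v \<ominus> \<one>) = snd u \<otimes>\<^bsub>N\<^esub> snd v" for u v
  have common: "real (card {w \<in> V. E (a, x) w \<and> E (b, y) w}) =
      real q * of_bool ((a, x) = (b, y)) + real t - real t * of_bool (a = b) - of_bool (x = y)"
    if ax: "a \<in> carrier R" "a \<noteq> \<zero>" "x \<in> carrier N" and bx: "b \<in> carrier R" "b \<noteq> \<zero>" "y \<in> carrier N" for a b x y
  proof -
    define W where "W = {w \<in> V. E (a, x) w \<and> E (b, y) w}"
    have W: "(c, z) \<in> W \<longleftrightarrow> c \<in> carrier R \<and> c \<noteq> \<zero> \<and> z \<in> carrier N \<and>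
        \<pi> (a \<otimes> c \<ominus> \<one>) = x \<otimes>\<^bsub>N\<^esub> z \<and> \<pi> (b \<otimes> c \<ominus> \<one>) = y \<otimes>\<^bsub>N\<^esub> z" for c z
      by (auto simp: W_def V_def E_def)
    consider "a = b" "x = y" | "a = b" "x \<noteq> y" | "a \<noteq> b" by blast
    then show ?thesis
    proof cases
      case 1
      have "bij_betw fst W (carrier R - {\<zero>})"
      proof (rule bij_betwI[where g = "\<lambda>c. (c, inv\<^bsub>N\<^esub> x \<otimes>\<^bsub>N\<^esub> \<pi> (a \<otimes> c \<ominus> \<one>))"])
        show "(\<lambda>c. (c, inv\<^bsub>N\<^esub> x \<otimes>\<^bsub>N\<^esub> \<pi> (a \<otimes> c \<ominus> \<one>))) \<in> carrier R - {\<zero>} \<rightarrow> W"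
          using ax 1 by (auto simp: W N.m_assoc[symmetric])
      qed (use ax 1 in \<open>auto simp: W N.m_assoc[symmetric]\<close>)
      then have "card W = q - 1" using bij_betw_same_card cardU by metis
      then show ?thesis using 1 q1 unfolding W_def[symmetric] by (simp add: of_nat_diff)
    next
      case 2
      have "W = {}" using 2 ax bx by (auto simp: W)
      then show ?thesis using 2 unfolding W_def[symmetric] by simp
    next
      case 3
      define d where "d = a \<ominus> b"
      have d: "d \<in> carrier R" "d \<noteq> \<zero>" using 3 ax bx by (auto simp: d_def)
      then have dU: "d \<in> Units R" by (simp add: field_Units)
      have ac: "a \<otimes> c \<ominus> \<one> = d \<otimes> c \<oplus> (b \<otimes> c \<ominus> \<one>)" if "c \<in> carrier R" for c
        unfolding d_def using that ax(1) bx(1) by algebra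
      define S where "S = {e \<in> carrier R. \<pi> e = x \<otimes>\<^bsub>N\<^esub> inv\<^bsub>N\<^esub> y}"
      have "bij_betw (\<lambda>(c, z). d \<otimes> c) W (S - {\<zero>})"
      proof (rule bij_betwI[where g = "\<lambda>e. (inv d \<otimes> e, inv\<^bsub>N\<^esub> y \<otimes>\<^bsub>N\<^esub> \<pi> (b \<otimes> (inv d \<otimes> e) \<ominus> \<one>))"])
        show "(\<lambda>(c, z). d \<otimes> c) \<in> W \<rightarrow> S - {\<zero>}"
        proof
          fix cz assume "cz \<in> W"
          then obtain c z where [simp]: "cz = (c, z)" and cz: "c \<in> carrier R" "c \<noteq> \<zero>" "z \<in> carrier N"
            "\<pi> (a \<otimes> c \<ominus> \<one>) = x \<otimes>\<^bsub>N\<^esub> z" "\<pi> (b \<otimes> c \<ominus> \<one>) = y \<otimes>\<^bsub>N\<^esub> z"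
            by (cases cz) (auto simp: W)
          have "\<pi> (d \<otimes> c) \<otimes>\<^bsub>N\<^esub> (y \<otimes>\<^bsub>N\<^esub> z) = x \<otimes>\<^bsub>N\<^esub> z"
            using \<pi>_add[of "d \<otimes> c" "b \<otimes> c \<ominus> \<one>"] cz d bx by (simp add: ac)
          then have "\<pi> (d \<otimes> c) \<otimes>\<^bsub>N\<^esub> y = x"
            using cz d ax bx by (simp add: N.m_assoc[symmetric])
          then have "\<pi> (d \<otimes> c) = x \<otimes>\<^bsub>N\<^esub> inv\<^bsub>N\<^esub> y"
            using cz d ax bx N.inv_solve_right[of "\<pi> (d \<otimes> c)" x y] by auto
          then show "(\<lambda>(c, z). d \<otimes> c) cz \<in> S - {\<zero>}" using cz d by (simp add: S_def integral_iff)
        qed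
        show "(\<lambda>e. (inv d \<otimes> e, inv\<^bsub>N\<^esub> y \<otimes>\<^bsub>N\<^esub> \<pi> (b \<otimes> (inv d \<otimes> e) \<ominus> \<one>))) \<in> S - {\<zero>} \<rightarrow> W"
        proof
          fix e assume "e \<in> S - {\<zero>}"
          then have e: "e \<in> carrier R" "e \<noteq> \<zero>" "\<pi> e = x \<otimes>\<^bsub>N\<^esub> inv\<^bsub>N\<^esub> y" by (auto simp: S_def)
          define c where "c = inv d \<otimes> e"
          have c: "c \<in> carrier R" using dU e by (simp add: c_def)
          have dc: "d \<otimes> c = e" using dU e d by (simp add: c_def m_assoc[symmetric])
          then have "c \<noteq> \<zero>" using e d by auto
          moreover have "\<pi> (a \<otimes> c \<ominus> \<one>) = x \<otimes>\<^bsub>N\<^esub> (inv\<^bsub>N\<^esub> y \<otimes>\<^bsub>N\<^esub> \<pi> (b \<otimes> c \<ominus> \<one>))"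
            using \<pi>_add[of "d \<otimes> c" "b \<otimes> c \<ominus> \<one>"] c d e ax bx by (simp add: ac dc N.m_assoc)
          moreover have "\<pi> (b \<otimes> c \<ominus> \<one>) = y \<otimes>\<^bsub>N\<^esub> (inv\<^bsub>N\<^esub> y \<otimes>\<^bsub>N\<^esub> \<pi> (b \<otimes> c \<ominus> \<one>))"
            using c bx by (simp add: N.m_assoc[symmetric])
          ultimately show "(inv d \<otimes> e, inv\<^bsub>N\<^esub> y \<otimes>\<^bsub>N\<^esub> \<pi> (b \<otimes> (inv d \<otimes> e) \<ominus> \<one>)) \<in> W"
            unfolding W c_def[symmetric] using c bx by simp
        qed
        show "(inv d \<otimes> (\<lambda>(c, z). d \<otimes> c) cz,
            inv\<^bsub>N\<^esub> y \<otimes>\<^bsub>N\<^esub> \<pi> (b \<otimes> (inv d \<otimes> (\<lambda>(c, z). d \<otimes> c) cz) \<ominus> \<one>)) = cz" if "cz \<in> W" for cz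
          using that dU d bx by (cases cz) (auto simp: W m_assoc[symmetric] N.m_assoc[symmetric])
        show "(\<lambda>(c, z). d \<otimes> c) (inv d \<otimes> e, inv\<^bsub>N\<^esub> y \<otimes>\<^bsub>N\<^esub> \<pi> (b \<otimes> (inv d \<otimes> e) \<ominus> \<one>)) = e"
          if "e \<in> S - {\<zero>}" for e
          using that dU d by (auto simp: S_def m_assoc[symmetric])
      qed
      then have "card W = card (S - {\<zero>})" by (rule bij_betw_same_card)
      moreover have "card S = t" unfolding S_def using ax bx by (intro fiber) simp
      moreover have "\<zero> \<in> S \<longleftrightarrow> x = y"
        using ax bx N.inv_solve_right[of "\<one>\<^bsub>N\<^esub>" x y] by (auto simp: S_def \<pi>_zero)
      ultimately have "real (card W) = real t - of_bool (x = y)"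
        using t by (simp add: card_Diff_singleton_if of_nat_diff)
      then show ?thesis using 3 unfolding W_def[symmetric] by simp
    qed
  qed
  show ?thesis
  proof (rule graph_of_common_counts[where V = V and E = E and r = fst and s = snd and ?u0.0 = "(\<one>, \<one>\<^bsub>N\<^esub>)"])
    show "finite V" using fin finN by (simp add: V_def)
    show "card V * t = q * (q - 1)" using cardN cardU by (simp add: V_def card_cartesian_product)
    show "E v u" if "u \<in> V" "v \<in> V" "E u v" for u v
      using that by (auto simp: E_def V_def m_comm N.m_comm)
    show "real (card {w \<in> V. E u w \<and> E v w}) =
        real q * of_bool (u = v) + real t - real t * of_bool (fst u = fst v) - of_bool (snd u = snd v)"
      if "u \<in> V" "v \<in> V" for u v
      using common[of "fst u" "snd u" "fst v" "snd v"] that by (auto simp: V_def)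
    show "E (\<one>, \<one>\<^bsub>N\<^esub>) (\<one>, \<one>\<^bsub>N\<^esub>)" by (simp add: E_def \<pi>_zero a_minus_def r_neg)
    assume tq: "t < q - 1"
    then have "card (carrier N) \<noteq> 1" using cardN by auto
    then obtain y where y: "y \<in> carrier N" "y \<noteq> \<one>\<^bsub>N\<^esub>"
      by (metis N.one_closed is_singletonI' is_singleton_altdef empty_iff)
    \<comment> \<open>One side of the grid is now indexed by units, so a unit other than
      \<open>\<one>\<close> is required; \<open>0 < t < q - 1\<close> gives
      \<open>q > 2\<close>.\<close>
    have "\<not> carrier R \<subseteq> {\<zero>, \<one>}"
      using card_mono[of "{\<zero>, \<one>}" "carrier R"] q tq t by auto
    then obtain a where a: "a \<in> carrier R" "a \<noteq> \<zero>" "a \<noteq> \<one>" by blast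
    show "\<exists>v\<in>V. \<exists>w\<in>V. \<exists>x\<in>V. fst v = fst (\<one>, \<one>\<^bsub>N\<^esub>) \<and> snd v \<noteq> snd (\<one>, \<one>\<^bsub>N\<^esub>) \<and>
        snd w = snd (\<one>, \<one>\<^bsub>N\<^esub>) \<and> fst w \<noteq> fst (\<one>, \<one>\<^bsub>N\<^esub>) \<and> fst x = fst w \<and> snd x = snd v"
      using a y by (intro bexI[of _ "(\<one>, y)"] bexI[of _ "(a, \<one>\<^bsub>N\<^esub>)"] bexI[of _ "(a, y)"]) (auto simp: V_def)
  qed (use t q1 in \<open>auto simp: V_def\<close>)
qed

section \<open>Subgroups of order \<open>t\<close> in the additive and multiplicative groups of the
  field\<close>

theorem theorem5:
  fixes q t :: nat
  assumes "primepow q"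
    and "t \<ge> 2"
    and "[q = 0] (mod t) \<or> [q = 1] (mod t)"
  shows "\<exists>G :: (nat, nat \<times> nat) pre_digraph.
           pseudo_graph G \<and>
           real (card (verts G)) = real q * (real q - 1) / real t \<and>
           nomulti_digraph G \<and> has_loop G \<and>
           regular_of_degree G (q - 1) \<and>
           complete_bipartite_free 2 (t + 1) G \<and>
           (t < q - 1 \<longrightarrow> second_largest_eigenvalue_is (adjacency_matrix G) (sqrt (real q)))"
proof -
  obtain F :: "((int list \<times> nat) multiset \<Rightarrow> int) ring"
    where F: "field F" and fin: "finite (carrier F)" and q: "card (carrier F) = q"
    using ex_field_of_primepow_order[OF assms(1)] .
  interpret F: field F by (rule F)
  obtain p k where p: "Factorial_Ring.prime p" and k: "0 < k" and qp: "q = p ^ k"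
    using assms(1) by (auto simp: primepow_def)
  have q1: "1 < q" unfolding qp using prime_gt_1_nat[OF p] k by (rule one_less_power)
  show ?thesis
    using assms(3)
  proof
    assume "[q = 0] (mod t)"
    then have "t dvd p ^ k" by (simp add: cong_0_iff qp)
    then obtain j where j: "j \<le> k" "t = p ^ j" using divides_primepow_nat[OF p] by blast
    have grp: "comm_group (add_monoid F)" by (rule F.a_comm_group)
    \<comment> \<open>Sylow's theorem is used for an arbitrary power of \<open>p\<close> dividing
      the order, so the cofactor may itself be divisible by \<open>p\<close>.\<close>
    have "order (add_monoid F) = p ^ j * p ^ (k - j)"
      using j q qp by (simp add: order_def power_add[symmetric])
    then obtain H where H: "subgroup H (add_monoid F)" "card H = t"
      using sylow_thm[OF p comm_group.axioms(2)[OF grp], of j "p ^ (k - j)"] fin j by auto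
    note quot = comm_group.quotient_hom[OF grp H(1)]
    show ?thesis
      by (rule F.ex_graph_additive[OF fin q _ quot(1) quot(2)])
        (use quot(3,4) fin q H(2) assms(2) in auto)
  next
    assume "[q = 1] (mod t)"
    then have tq: "t dvd q - 1" using q1 by (simp add: cong_altdef_nat)
    let ?U = "Multiplicative_Group.mult_of F"
    have grp: "comm_group ?U"
      by (rule group.group_comm_groupI[OF F.field_mult_group]) (auto simp: F.m_comm)
    interpret U: comm_group ?U by (rule grp)
    have finU: "finite (carrier ?U)" using fin by simp
    have cardU: "card (carrier ?U) = q - 1" using fin q by simp
    \<comment> \<open>The unit group is cyclic. With a generator \<open>g\<close> and
      \<open>q - 1 = t * m\<close>, the \<open>m\<close>-th power of \<open>g\<close> has order
      \<open>t\<close> and generates the subgroup to be divided out.\<close>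
    obtain g where g: "g \<in> carrier ?U" "carrier ?U = {g [^]\<^bsub>F\<^esub> i |i::nat. i \<in> UNIV}"
      using F.finite_field_mult_group_has_gen[OF fin] by blast
    have "U.ord g = q - 1"
    proof -
      have "U.ord g \<noteq> 0" using U.ord_ge_1[OF finU g(1)] by simp
      then have "generate ?U {g} = carrier ?U" using U.generate_pow_nat[OF g(1)] g(2) by (simp add: Multiplicative_Group.nat_pow_mult_of)
      then show ?thesis using U.generate_pow_card[OF g(1)] cardU by simp
    qed
    moreover obtain m where m: "q - 1 = t * m" using tq by blast
    then have "m \<noteq> 0" using q1 by (cases m) auto
    ultimately have "U.ord (g [^]\<^bsub>?U\<^esub> m) = t"
      using U.ord_pow[OF g(1), of m] m by simp
    moreover have gm: "g [^]\<^bsub>?U\<^esub> m \<in> carrier ?U" using g(1) by (rule U.nat_pow_closed)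
    ultimately have H: "subgroup (generate ?U {g [^]\<^bsub>?U\<^esub> m}) ?U" "card (generate ?U {g [^]\<^bsub>?U\<^esub> m}) = t"
      using U.generate_is_subgroup[of "{g [^]\<^bsub>?U\<^esub> m}"] U.generate_pow_card[OF gm] by auto
    note quot = comm_group.quotient_hom[OF grp H(1) finU]
    show ?thesis
      by (rule F.ex_graph_multiplicative[OF fin q _ quot(1) quot(2)])
        (use quot(3,4) H(2) assms(2) in auto)
  qed
qed

end
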